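(* Let $\Phi$ be a non-autonomous infinite conformal iterated function system (with $I_k=\mathbb N_+$ for every $k$, and $\{\|D\varphi_{n,k}\|\}_{k\ge1}$ monotonically decreasing in $k$ for each $n$) satisfying the open set condition and the cone condition, and let $E\subset\mathbb R^d$ be its non-autonomous infinite conformal set. Suppose that $m_\Phi=\inf\{\underline P(t):\underline P(t)>0\}>0$. Suppose there exists $0<M<1$ such that for all $t\in(0,d)$: (1) the sums $\sum_{k\in I_n}\|D\varphi_{n,k}\|^t$ are either infinite for all $n$ or finite for all $n$; (2) if $\sum_{k\in I_n}\|D\varphi_{n,k}\|^t<\infty$ (for all $n$), then $$\lim_{n\to\infty}\frac{\sum_{k\le e^{Mm_\Phi n}}\|D\varphi_{n,k}\|^t}{\sum_{j\in I_n}\|D\varphi_{n,j}\|^t}=1;$$ (3) if $\sum_{k\in I_n}\|D\varphi_{n,k}\|^t=\infty$ (for all $n$), then $\lim_{n\to\infty}\sum_{k\le e^{Mm_\Phi n}}\|D\varphi_{n,k}\|^t=\infty$. Then $\dim_{\rm H}E=s_*$.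
   Context: Words. $\{I_k\}_{k\ge 1}$ is a sequence of countably infinite index sets, $I_k=\mathbb N_+$. For $k\ge l\ge 1$, $\Sigma_l^k=\{u_l\cdots u_k: u_j\in I_j\}$; $\Sigma^k=\Sigma_1^k$, $\Sigma^0=\{\emptyset\}$, $\Sigma^*=\bigcup_{k\ge 0}\Sigma^k$. System. $J\subset\mathbb R^d$ is compact with non-empty interior and $\overline{\mathrm{int}(J)}=J$. For each $k\ge1$, $\Phi_k=\{\varphi_{k,i}\}_{i\in I_k}$ is a family of maps $\varphi_{k,i}:J\to J$. For $\mathbf u=u_l\cdots u_k\in\Sigma_l^k$, $\varphi_{\mathbf u}=\varphi_{l,u_l}\circ\cdots\circ\varphi_{k,u_k}$ (and $\varphi_\emptyset=\mathrm{id}$). $\Phi=\{\Phi_k\}_{k\ge1}$, together with a family $\{J_{\mathbf u}:\mathbf u\in\Sigma^*\}$ of closed subsets of $J$, is a non-autonomous infinite iterated function system if: (i) there is $0<c<1$ with $|\varphi_{k,i}(x)-\varphi_{k,i}(y)|\le c|x-y|$ for all $k$, $i\in I_k$, $x,y\in J$; (ii) $J_\emptyset=J$ and $J_{\mathbf u i}\subset J_{\mathbf u}$ for all $\mathbf u\in\Sigma^{k-1}$, $i\in I_k$, $k\ge1$; (iii) for each $\mathbf u\in\Sigma^*$ there is $\omega_{\mathbf u}\in\mathbb R^d$ such that $J_{\mathbf u}=\Psi_{\mathbf u}(J)$ with $\Psi_{\mathbf u}=\varphi_{\mathbf u}+\omega_{\mathbf u}$. Its attractor is $E=\bigcap_{k\ge1}\bigcup_{\mathbf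 u\in\Sigma^k}J_{\mathbf u}$. The open set condition (OSC) means: for all $k\ge0$, $\mathbf u\in\Sigma^k$ and $i\ne j\in I_{k+1}$, $\mathrm{int}(J_{\mathbf ui})\cap\mathrm{int}(J_{\mathbf uj})=\emptyset$. Conformality. $\Phi$ is conformal (and $E$ is called a non-autonomous infinite conformal set) if there is an open connected set $V\supset J$, independent of $k$, such that each $\varphi_{k,j}$ extends to a $C^1$ conformal diffeomorphism of $V$ into $V$ (the derivative at each point is a similarity linear map), and there is $C\ge1$ with $\|D\varphi_{\mathbf u}(x)\|\le C\|D\varphi_{\mathbf u}(y)\|$ for all $x,y\in V$ and all $\mathbf u\in\Sigma_l^k$, $k\ge l\ge1$. Here $\|D\varphi(x)\|$ is the scaling factor of $D\varphi(x)$ and $\|D\varphi\|=\sup_{x\in J}\|D\varphi(x)\|$. Cone condition. $\Phi$ satisfies the cone condition if there exist $\alpha,l>0$ such that for every $x\in\partial J$ there is an open cone $\mathrm{Con}(x,u_x,\alpha,l)\subset\mathrm{int}(J)$ with vertex $x$, direction vector $u_x$, central angle of Lebesgue measure $\alpha$ and altitude $l$. Lower pressure (values in $[-\infty,+\infty]$): $\underline P(t)=\liminf_{k\to\infty}\frac1k\log\sum_{\mathbf u\in\Sigma^k}\|D\varphi_{\mathbf u}\|^t$, and $s_*=\inf\{t:\underline P(t)<0\}=\sup\{t:\underline P(t)>0\}$.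
   Formalization: The formal statement takes m_Φ to be finite (0 < m_Φ < ∞); for m_Φ = ∞ the cutoff e^{M m_Φ n} is undefined, and read as ∞ it makes (2) and (3) vacuous and the claim false. *)

theory Defs
  imports "HOL-Analysis.Analysis"
begin

text \<open>
  The empty set contributes 0, and \<open>0\<^sup>0 = 1\<close> for nonempty sets of diameter 0
  (whereas \<open>0 powr 0 = 0\<close> in the library).
\<close>
definition diam_pow :: "real \<Rightarrow> 'a::metric_space set \<Rightarrow> ennreal" where
  "diam_pow s U =
     (if U = {} then 0 else if s = 0 then 1 else ennreal (diameter U powr s))"

text \<open>Boundedness is required because \<^const>\<open>diameter\<close> is meaningless on unbounded sets.\<close>
definition hausdorff_premeasure :: "real \<Rightarrow> real \<Rightarrow> 'a::metric_space set \<Rightarrow> ennreal" where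
  "hausdorff_premeasure s \<delta> A =
     (INF U \<in> {U :: nat \<Rightarrow> 'a set. A \<subseteq> (\<Union>i. U i) \<and> (\<forall>i. bounded (U i) \<and> diameter (U i) \<le> \<delta>)}.
        \<Sum>i. diam_pow s (U i))"

definition hausdorff_measure :: "real \<Rightarrow> 'a::metric_space set \<Rightarrow> ennreal" where
  "hausdorff_measure s A = (SUP \<delta> \<in> {0<..}. hausdorff_premeasure s \<delta> A)"

definition hausdorff_dim :: "'a::metric_space set \<Rightarrow> ereal" where
  "hausdorff_dim A = Inf (ereal ` {s. 0 \<le> s \<and> hausdorff_measure s A = 0})"

text \<open>
  Every index set is \<open>{1..}\<close>. A word \<open>u\<^sub>l \<cdots> u\<^sub>k\<close> is the list of its letters; since the list does not
  record the level \<open>l\<close> of its first letter, this level is an argument of \<open>word_map\<close>.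
  \<open>words 1 0 = {[]}\<close> contains the empty word only.
\<close>
definition words :: "nat \<Rightarrow> nat \<Rightarrow> nat list set" where
  "words l k = {u. length u = Suc k - l \<and> set u \<subseteq> {1..}}"

fun word_map :: "(nat \<Rightarrow> nat \<Rightarrow> 'a \<Rightarrow> 'a) \<Rightarrow> nat \<Rightarrow> nat list \<Rightarrow> 'a \<Rightarrow> 'a" where
  "word_map \<phi> l [] = id"
| "word_map \<phi> l (i # u) = \<phi> l i \<circ> word_map \<phi> (Suc l) u"

text \<open>
  The maps are total functions. In \<open>nonauto_ifs\<close> only their values on \<open>J\<close> matter; in the conformal
  setting \<open>\<phi> k i\<close> also denotes the extension to the neighbourhood \<open>V\<close> of \<open>J\<close>.
\<close>
definition nonauto_ifs ::
  "'a::euclidean_space set \<Rightarrow> (nat \<Rightarrow> nat \<Rightarrow> 'a \<Rightarrow> 'a) \<Rightarrow> (nat list \<Rightarrow> 'a set) \<Rightarrow> bool" where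
  "nonauto_ifs J \<phi> Jw \<longleftrightarrow>
     compact J \<and> interior J \<noteq> {} \<and> closure (interior J) = J \<and>
     (\<forall>k\<ge>1. \<forall>i\<ge>1. \<phi> k i ` J \<subseteq> J) \<and>
     (\<exists>c. 0 < c \<and> c < 1 \<and>
        (\<forall>k\<ge>1. \<forall>i\<ge>1. \<forall>x\<in>J. \<forall>y\<in>J. norm (\<phi> k i x - \<phi> k i y) \<le> c * norm (x - y))) \<and>
     (\<forall>k. \<forall>u\<in>words 1 k. closed (Jw u) \<and> Jw u \<subseteq> J) \<and>
     Jw [] = J \<and>
     (\<forall>k\<ge>1. \<forall>u\<in>words 1 (k - 1). \<forall>i\<ge>1. Jw (u @ [i]) \<subseteq> Jw u) \<and>
     (\<forall>k. \<forall>u\<in>words 1 k. \<exists>\<omega>. Jw u = (\<lambda>x. word_map \<phi> 1 u x + \<omega>) ` J)"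

definition attractor :: "(nat list \<Rightarrow> 'a set) \<Rightarrow> 'a set" where
  "attractor Jw = (\<Inter>k\<in>{1..}. \<Union>u\<in>words 1 k. Jw u)"

definition open_set_condition :: "(nat list \<Rightarrow> 'a::topological_space set) \<Rightarrow> bool" where
  "open_set_condition Jw \<longleftrightarrow>
     (\<forall>k. \<forall>u\<in>words 1 k. \<forall>i\<ge>1. \<forall>j\<ge>1. i \<noteq> j \<longrightarrow>
        interior (Jw (u @ [i])) \<inter> interior (Jw (u @ [j])) = {})"

definition C1_on :: "'a::euclidean_space set \<Rightarrow> ('a \<Rightarrow> 'a) \<Rightarrow> bool" where
  "C1_on V f \<longleftrightarrow>
     (\<exists>f' :: 'a \<Rightarrow> 'a \<Rightarrow>\<^sub>L 'a.
        (\<forall>x\<in>V. (f has_derivative blinfun_apply (f' x)) (at x)) \<and> continuous_on V f')"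

definition similarity_linear :: "('a::euclidean_space \<Rightarrow> 'a) \<Rightarrow> bool" where
  "similarity_linear L \<longleftrightarrow> linear L \<and> (\<exists>r>0. \<forall>v. norm (L v) = r * norm v)"

definition conformal_diffeo_into :: "'a::euclidean_space set \<Rightarrow> ('a \<Rightarrow> 'a) \<Rightarrow> bool" where
  "conformal_diffeo_into V f \<longleftrightarrow>
     f ` V \<subseteq> V \<and> inj_on f V \<and> C1_on V f \<and>
     open (f ` V) \<and> C1_on (f ` V) (inv_into V f) \<and>
     (\<forall>x\<in>V. similarity_linear (frechet_derivative f (at x)))"

text \<open>For a similarity linear map the operator norm is its scaling factor.\<close>
definition deriv_norm :: "('a::euclidean_space \<Rightarrow> 'a) \<Rightarrow> 'a \<Rightarrow> real" where
  "deriv_norm f x = onorm (frechet_derivative f (at x))"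

definition sup_deriv_norm :: "'a::euclidean_space set \<Rightarrow> ('a \<Rightarrow> 'a) \<Rightarrow> real" where
  "sup_deriv_norm J f = (SUP x\<in>J. deriv_norm f x)"

definition conformal_system ::
  "'a::euclidean_space set \<Rightarrow> (nat \<Rightarrow> nat \<Rightarrow> 'a \<Rightarrow> 'a) \<Rightarrow> bool" where
  "conformal_system J \<phi> \<longleftrightarrow>
     (\<exists>V. open V \<and> connected V \<and> J \<subseteq> V \<and>
        (\<forall>k\<ge>1. \<forall>j\<ge>1. conformal_diffeo_into V (\<phi> k j)) \<and>
        (\<exists>C\<ge>1. \<forall>l\<ge>1. \<forall>k\<ge>l. \<forall>u\<in>words l k. \<forall>x\<in>V. \<forall>y\<in>V.
           deriv_norm (word_map \<phi> l u) x \<le> C * deriv_norm (word_map \<phi> l u) y))"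

text \<open>
  The open cone with vertex \<open>x\<close>, axis along the unit vector \<open>v\<close>, full opening angle \<open>\<alpha>\<close> (so the
  angle between \<open>y - x\<close> and \<open>v\<close> is less than \<open>\<alpha> / 2\<close>) and altitude \<open>l\<close>.
\<close>
definition open_cone :: "'a::euclidean_space \<Rightarrow> 'a \<Rightarrow> real \<Rightarrow> real \<Rightarrow> 'a set" where
  "open_cone x v \<alpha> l =
     {y. norm (y - x) * cos (\<alpha> / 2) < (y - x) \<bullet> v \<and> (y - x) \<bullet> v < l}"

definition cone_condition :: "'a::euclidean_space set \<Rightarrow> bool" where
  "cone_condition J \<longleftrightarrow>
     (\<exists>\<alpha> l. 0 < \<alpha> \<and> \<alpha> < pi \<and> 0 < l \<and>
        (\<forall>x\<in>frontier J. \<exists>v. norm v = 1 \<and> open_cone x v \<alpha> l \<subseteq> interior J))"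

definition ln_ennreal :: "ennreal \<Rightarrow> ereal" where
  "ln_ennreal x =
     (if x = 0 then -\<infinity> else if x = \<infinity> then \<infinity> else ereal (ln (enn2real x)))"

definition lower_pressure ::
  "'a::euclidean_space set \<Rightarrow> (nat \<Rightarrow> nat \<Rightarrow> 'a \<Rightarrow> 'a) \<Rightarrow> real \<Rightarrow> ereal" where
  "lower_pressure J \<phi> t =
     liminf (\<lambda>k. ereal (1 / real k) *
       ln_ennreal (\<Sum>\<^sub>\<infinity>u\<in>words 1 k. ennreal (sup_deriv_norm J (word_map \<phi> 1 u) powr t)))"

definition s_lower ::
  "'a::euclidean_space set \<Rightarrow> (nat \<Rightarrow> nat \<Rightarrow> 'a \<Rightarrow> 'a) \<Rightarrow> ereal" where
  "s_lower J \<phi> = Inf (ereal ` {t. lower_pressure J \<phi> t < 0})"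

definition m_pressure ::
  "'a::euclidean_space set \<Rightarrow> (nat \<Rightarrow> nat \<Rightarrow> 'a \<Rightarrow> 'a) \<Rightarrow> ereal" where
  "m_pressure J \<phi> = Inf {lower_pressure J \<phi> t | t. lower_pressure J \<phi> t > 0}"

end

theory Submission
  imports Defs "HOL-Real_Asymp.Real_Asymp"
begin

text \<open>
  Write \<open>q(u)\<close> for the scaling factor \<open>\<parallel>D\<phi>\<^sub>u\<parallel>\<close> of a word \<open>u\<close> and \<open>P\<close> for the lower pressure. Bounded
  distortion makes \<open>q\<close> multiplicative up to the constant \<open>C\<close> and makes \<open>q(u)\<close> comparable with
  the size of the piece \<open>J\<^sub>u\<close>: its diameter is at most a constant times \<open>q(u)\<close>, and
  by the cone condition it contains, near each of its points and at each smaller scale, a ball of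
  comparable radius (\<open>inner_ball_Jw\<close>).

  The upper bound is the obvious covering argument. If \<open>P(t) < 0\<close>, the sums of \<open>q(u)\<^sup>t\<close> over the
  words of length \<open>k\<close> tend to 0 along a subsequence, and these words index covers of the
  attractor by sets of diameter at most a constant times \<open>q(u)\<close> (\<open>hausdorff_measure_attractor_zero\<close>).

  For the lower bound let \<open>0 < t < t' < s\<^sub>*\<close>. Then \<open>P(t') \<ge> 0\<close>, and \<open>P(t) > 0\<close> because the pressure rises by at
  least a fixed multiple of \<open>t' - t\<close> when the exponent is lowered from \<open>t'\<close> to \<open>t\<close>. Moreover
  \<open>t' \<le> DIM('a)\<close>, because the packing of disjoint balls forces \<open>P < 0\<close> beyond the dimension.
  So \<open>P(t) \<ge> m\<close>. Keep at level \<open>n\<close> only the letters up to \<open>exp (M * m * n)\<close>. The hypotheses on the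
  one-letter sums guarantee that the truncated partition functions still grow faster
  than \<open>exp (\<gamma> * n)\<close> for some \<open>\<gamma> > M * m\<close>: in the summable case the truncation costs a subexponential
  factor, in the divergent case the truncated sums grow faster than any exponential.
  Thus the growth rate of the partition functions beats that of the alphabets.

  This gap is what the mass distribution needs (\<open>hausdorff_measure_attractor_pos\<close>). With infinitely many
  letters, a word of size just above \<open>r\<close> may have a great many children of size below \<open>r\<close> near a given ball
  of radius \<open>r\<close>, and disjointness does not control their number. At
  each level, however, only boundedly many words of size above \<open>r\<close> come near the ball; they have at most
  \<open>exp (M * m * n)\<close> children each, and the mass of a child is at most a constant times
  \<open>r\<^sup>t * exp (- \<gamma> * n)\<close>. The sum over all levels is at most a constant times \<open>r\<^sup>t\<close>, so the attractor has
  positive \<open>t\<close>-dimensional Hausdorff measure.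
\<close>

section \<open>Conformal maps of an open set\<close>

text \<open>
  Only the infinitesimal part of \<^const>\<open>conformal_diffeo_into\<close> is kept. Injectivity and invariance of
  the domain are stated separately where they matter, because this part alone is what the
  Lipschitz estimates use, and it passes to compositions by the chain rule.
\<close>

definition conformal_on :: "'a::euclidean_space set \<Rightarrow> ('a \<Rightarrow> 'a) \<Rightarrow> bool" where
  "conformal_on V f \<longleftrightarrow>
     (\<forall>x\<in>V. f differentiable (at x) \<and> similarity_linear (frechet_derivative f (at x)))"

lemma similarity_linear_onorm:
  fixes L :: "'a::euclidean_space \<Rightarrow> 'a"
  assumes "similarity_linear L"
  shows "norm (L v) = onorm L * norm v" and "onorm L > 0"
proof -
  obtain r where L: "linear L" and r: "r > 0" "\<And>v. norm (L v) = r * norm v"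
    using assms by (auto simp: similarity_linear_def)
  obtain b :: 'a where b: "b \<in> Basis"
    using nonempty_Basis by blast
  have "onorm L \<le> r"
    using r by (intro onorm_bound) auto
  moreover have "r \<le> onorm L"
    using onorm[of L b] L r(2)[of b] b by (simp add: linear_conv_bounded_linear)
  ultimately have "onorm L = r" by simp
  with r show "norm (L v) = onorm L * norm v" "onorm L > 0" by auto
qed

lemma conformal_onD:
  assumes "conformal_on V f" "x \<in> V"
  shows "(f has_derivative frechet_derivative f (at x)) (at x)"
    and "norm (frechet_derivative f (at x) v) = deriv_norm f x * norm v"
    and "deriv_norm f x > 0"
  using assms similarity_linear_onorm[of "frechet_derivative f (at x)"]
  by (auto simp: conformal_on_def deriv_norm_def frechet_derivative_works)

lemma conformal_on_continuous: "conformal_on V f \<Longrightarrow> continuous_on V f"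
  by (meson conformal_onD(1) continuous_at_imp_continuous_on has_derivative_continuous)

lemma similarity_linear_compose:
  assumes "similarity_linear L" "similarity_linear K"
  shows "similarity_linear (L \<circ> K)"
proof -
  obtain r s where "linear L" "linear K" and rs: "r > 0" "s > 0"
    "\<And>v. norm (L v) = r * norm v" "\<And>v. norm (K v) = s * norm v"
    using assms by (auto simp: similarity_linear_def)
  then show ?thesis
    unfolding similarity_linear_def
    by (intro conjI linear_compose exI[of _ "r * s"]) auto
qed

lemma conformal_on_compose:
  assumes f: "conformal_on V f" and g: "conformal_on V g" and gV: "g ` V \<subseteq> V"
  shows "conformal_on V (f \<circ> g)"
    and "x \<in> V \<Longrightarrow> deriv_norm (f \<circ> g) x = deriv_norm f (g x) * deriv_norm g x"
proof -
  have D: "frechet_derivative (f \<circ> g) (at x) =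
      frechet_derivative f (at (g x)) \<circ> frechet_derivative g (at x)"
    "(f \<circ> g) differentiable (at x)" if "x \<in> V" for x
  proof -
    have gx: "g x \<in> V" using gV that by auto
    have "((f \<circ> g) has_derivative
        (frechet_derivative f (at (g x)) \<circ> frechet_derivative g (at x))) (at x)"
      by (rule diff_chain_at[OF conformal_onD(1)[OF g that] conformal_onD(1)[OF f gx]])
    then show "frechet_derivative (f \<circ> g) (at x) =
      frechet_derivative f (at (g x)) \<circ> frechet_derivative g (at x)"
      "(f \<circ> g) differentiable (at x)"
      by (auto dest: frechet_derivative_at simp: differentiable_def)
  qed
  show comp: "conformal_on V (f \<circ> g)"
    unfolding conformal_on_def
  proof (intro ballI conjI)
    fix x assume x: "x \<in> V"
    then have gx: "g x \<in> V" using gV by auto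
    show "(f \<circ> g) differentiable at x" using D x by simp
    show "similarity_linear (frechet_derivative (f \<circ> g) (at x))"
      unfolding D(1)[OF x]
      using f g x gx by (intro similarity_linear_compose) (auto simp: conformal_on_def)
  qed
  show "deriv_norm (f \<circ> g) x = deriv_norm f (g x) * deriv_norm g x" if x: "x \<in> V"
  proof -
    have gx: "g x \<in> V" using gV x by auto
    obtain b :: 'a where b: "b \<in> Basis"
      using nonempty_Basis by blast
    have "deriv_norm (f \<circ> g) x = norm (frechet_derivative (f \<circ> g) (at x) b)"
      using conformal_onD(2)[OF comp x, of b] b by simp
    also have "\<dots> = deriv_norm f (g x) * deriv_norm g x"
      unfolding D(1)[OF x] using b
      by (simp add: conformal_onD(2)[OF f gx] conformal_onD(2)[OF g x])
    finally show ?thesis .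
  qed
qed

lemma conformal_on_id:
  fixes V :: "'a::euclidean_space set" and x :: 'a
  shows "conformal_on V id" "deriv_norm id x = 1"
proof -
  have F: "frechet_derivative id (at x) = (\<lambda>v. v)" for x :: 'a
    using frechet_derivative_at[OF has_derivative_id] by (simp add: id_def)
  show "conformal_on V id"
    unfolding conformal_on_def F
    by (auto simp: similarity_linear_def id_def linear_iff intro: exI[of _ "1::real"])
  show "deriv_norm id x = 1"
    unfolding deriv_norm_def F by (rule onorm_id)
qed

text \<open>
  The mean value inequality. It is stated on balls because \<open>V\<close> need not be convex.
\<close>

lemma conformal_on_lipschitz_ball:
  assumes f: "conformal_on V f" and sub: "ball x r \<subseteq> V" and y: "y \<in> ball x r"
    and B: "\<And>z. z \<in> V \<Longrightarrow> deriv_norm f z \<le> B"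
  shows "dist (f x) (f y) \<le> B * dist x y"
proof -
  have x: "x \<in> ball x r" using y by (auto intro: le_less_trans[OF zero_le_dist])
  have "norm (f x - f y) \<le> B * norm (x - y)"
  proof (rule differentiable_bound[where S = "ball x r"])
    fix z assume z: "z \<in> ball x r"
    then have zV: "z \<in> V" using sub by auto
    show "(f has_derivative frechet_derivative f (at z)) (at z within ball x r)"
      using conformal_onD(1)[OF f zV] by (rule has_derivative_at_withinI)
    show "onorm (frechet_derivative f (at z)) \<le> B"
      using B[OF zV] by (simp add: deriv_norm_def)
  qed (use x y in auto)
  then show ?thesis by (simp add: dist_norm)
qed

text \<open>
  For a similarity, the scaling factor can be read off from the displacement in a single direction,
  here along a basis vector.
\<close>

lemma deriv_norm_le_lipschitz:
  assumes f: "conformal_on V f" "x \<in> V" and S: "open S" "x \<in> S"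
    and lip: "\<And>y. y \<in> S \<Longrightarrow> norm (f y - f x) \<le> K * norm (y - x)"
  shows "deriv_norm f x \<le> K"
proof (rule field_le_epsilon)
  fix e :: real assume e: "e > 0"
  let ?D = "frechet_derivative f (at x)"
  obtain d where d: "d > 0"
    "\<And>y. norm (y - x) < d \<Longrightarrow> norm (f y - f x - ?D (y - x)) \<le> e * norm (y - x)"
    using conformal_onD(1)[OF f] e unfolding has_derivative_at_alt by blast
  obtain d' where d': "d' > 0" "ball x d' \<subseteq> S" using S by (meson openE)
  obtain b :: 'a where b: "b \<in> Basis" using nonempty_Basis by blast
  define h where "h = min d d' / 2"
  have h: "0 < h" "h < d" "h < d'" using d d' by (auto simp: h_def)
  define y where "y = x + h *\<^sub>R b"
  have y: "norm (y - x) = h" "y \<in> S" using h b d'(2) by (auto simp: y_def dist_norm subset_eq)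
  have "deriv_norm f x * h = norm (?D (y - x))"
    using conformal_onD(2)[OF f] y(1) by simp
  also have "\<dots> \<le> norm (f y - f x) + norm (f y - f x - ?D (y - x))"
    using norm_triangle_ineq4[of "f y - f x" "f y - f x - ?D (y - x)"] by simp
  also have "\<dots> \<le> K * h + e * h"
    using lip[OF y(2)] d(2)[of y] y(1) h by (intro add_mono) auto
  finally have "deriv_norm f x * h \<le> (K + e) * h" by (simp add: distrib_right)
  then show "deriv_norm f x \<le> K + e" using h by simp
qed

text \<open>
  Neither \<open>J\<close> nor \<open>V\<close> need be convex, so the mean value inequality does not bound the diameter of \<open>f ` J\<close>
  directly. Points of \<open>V\<close> can be joined by finite chains of balls in \<open>V\<close>, and by compactness the
  length of the chains is bounded on \<open>J\<close>. What matters is that the constant \<open>L\<close> serves all maps \<open>f\<close> at once.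
\<close>

lemma compact_chain_bound:
  fixes V J :: "'a::euclidean_space set"
  assumes V: "open V" "connected V" and J: "compact J" "J \<subseteq> V"
  obtains L where "L > 0" and
    "\<And>f B x y. conformal_on V f \<Longrightarrow> (\<And>z. z \<in> V \<Longrightarrow> deriv_norm f z \<le> B) \<Longrightarrow> x \<in> J \<Longrightarrow> y \<in> J \<Longrightarrow>
       dist (f x) (f y) \<le> L * B"
proof -
  define K where "K = {(f, B). conformal_on V f \<and> (\<forall>z\<in>V. deriv_norm f z \<le> B)}"
  have Kpos: "B \<ge> 0" if "(f, B) \<in> K" "x \<in> V" for f B x
    using that conformal_onD(3)[of V f x] by (fastforce simp: K_def)
  have loc: "\<exists>e>0. ball x e \<subseteq> V \<and> (\<forall>y\<in>ball x e. \<forall>(f, B)\<in>K. dist (f x) (f y) \<le> e * B)"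
    if x: "x \<in> V" for x
  proof -
    obtain e where e: "e > 0" "ball x e \<subseteq> V" using V(1) x by (meson openE)
    have "dist (f x) (f y) \<le> e * B" if "y \<in> ball x e" "(f, B) \<in> K" for y f B
    proof -
      have "dist (f x) (f y) \<le> B * dist x y"
        using that e by (intro conformal_on_lipschitz_ball[of V f x e y]) (auto simp: K_def)
      also have "\<dots> \<le> B * e"
        using that Kpos[OF that(2) x] by (intro mult_left_mono) auto
      finally show ?thesis by (simp add: mult.commute)
    qed
    with e show ?thesis by blast
  qed
  \<comment> \<open>joined by a chain: an equivalence relation with open classes, hence trivial on \<open>V\<close>\<close>
  define R where "R x y \<longleftrightarrow> (\<exists>L. \<forall>(f, B)\<in>K. dist (f x) (f y) \<le> L * B)" for x y :: 'a
  have R: "R x y" if "x \<in> V" "y \<in> V" for x y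
  proof (rule connected_equivalence_relation[OF V(2) that, of R])
    show "R b a" if "R a b" for a b
      using that by (simp add: R_def dist_commute)
  next
    fix a b d assume "R a b" "R b d"
    then obtain L1 L2 where L: "\<forall>(f, B)\<in>K. dist (f a) (f b) \<le> L1 * B"
      "\<forall>(f, B)\<in>K. dist (f b) (f d) \<le> L2 * B"
      by (auto simp: R_def)
    have "\<forall>(f, B)\<in>K. dist (f a) (f d) \<le> (L1 + L2) * B"
    proof clarify
      fix f B assume "(f, B) \<in> K"
      then show "dist (f a) (f d) \<le> (L1 + L2) * B"
        using L dist_triangle[of "f a" "f d" "f b"] by (fastforce simp: distrib_right)
    qed
    then show "R a d" unfolding R_def by blast
  next
    fix a assume a: "a \<in> V"
    obtain e where "e > 0" "ball a e \<subseteq> V" "\<forall>y\<in>ball a e. \<forall>(f, B)\<in>K. dist (f a) (f y) \<le> e * B"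
      using loc[OF a] by blast
    then show "\<exists>T. openin (top_of_set V) T \<and> a \<in> T \<and> (\<forall>x\<in>T. R a x)"
      using V(1) unfolding R_def
      by (intro exI[of _ "ball a e"] conjI ballI exI[of _ e]) (auto simp: openin_open_eq)
  qed
  show thesis
  proof (cases "J = {}")
    case True
    then show ?thesis using that[of 1] by auto
  next
    case False
    then obtain x0 where x0: "x0 \<in> J" by blast
    define G where "G n = interior {z. \<forall>(f, B)\<in>K. dist (f x0) (f z) \<le> real n * B}" for n :: nat
    have "J \<subseteq> (\<Union>n\<in>UNIV. G n)"
    proof
      fix x assume "x \<in> J"
      then have x: "x \<in> V" "x0 \<in> V" using J x0 by auto
      obtain L where L: "\<forall>(f, B)\<in>K. dist (f x0) (f x) \<le> L * B"
        using R[OF x(2,1)] by (auto simp: R_def)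
      obtain e where e: "e > 0" "\<forall>y\<in>ball x e. \<forall>(f, B)\<in>K. dist (f x) (f y) \<le> e * B"
        using loc[OF x(1)] by blast
      obtain n :: nat where n: "L + e \<le> real n" using real_arch_simple by blast
      have "ball x e \<subseteq> {z. \<forall>(f, B)\<in>K. dist (f x0) (f z) \<le> real n * B}"
      proof (clarify)
        fix y f B assume y: "y \<in> ball x e" and fB: "(f, B) \<in> K"
        have "dist (f x0) (f y) \<le> L * B + e * B"
          using L e(2) y fB dist_triangle[of "f x0" "f y" "f x"] by fastforce
        also have "\<dots> \<le> real n * B"
          using n Kpos[OF fB x(1)] by (metis distrib_right mult_right_mono)
        finally show "dist (f x0) (f y) \<le> real n * B" .
      qed
      then have "x \<in> G n"
        unfolding G_def using e(1) by (meson centre_in_ball interior_maximal open_ball subsetD)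
      then show "x \<in> (\<Union>n\<in>UNIV. G n)" by blast
    qed
    then obtain D where D: "finite D" "J \<subseteq> (\<Union>n\<in>D. G n)"
      by (rule compactE_image[OF J(1), rotated]) (auto simp: G_def)
    have D0: "D \<noteq> {}" using D x0 by auto
    define N where "N = Max D"
    have bd: "dist (f x0) (f x) \<le> real N * B" if fB: "(f, B) \<in> K" and "x \<in> J" for f B x
    proof -
      obtain n where n: "n \<in> D" "x \<in> G n" using subsetD[OF D(2) \<open>x \<in> J\<close>] by (rule UN_E)
      then have "dist (f x0) (f x) \<le> real n * B"
        using interior_subset fB by (fastforce simp: G_def)
      also have "\<dots> \<le> real N * B"
        using n D Kpos[OF fB, of x] that J by (intro mult_right_mono) (auto simp: N_def)
      finally show ?thesis .
    qed
    show thesis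
    proof (rule that[of "2 * real N + 1"])
      fix f B x y assume f: "conformal_on V f" "\<And>z. z \<in> V \<Longrightarrow> deriv_norm f z \<le> B"
        and xy: "x \<in> J" "y \<in> J"
      then have K: "(f, B) \<in> K" by (auto simp: K_def)
      have "dist (f x) (f y) \<le> dist (f x0) (f x) + dist (f x0) (f y)"
        by (metis dist_commute dist_triangle)
      also have "\<dots> \<le> (2 * real N) * B"
        using bd[OF K xy(1)] bd[OF K xy(2)] by simp
      also have "\<dots> \<le> (2 * real N + 1) * B"
        using Kpos[OF K, of x] xy J by (intro mult_right_mono) auto
      finally show "dist (f x) (f y) \<le> (2 * real N + 1) * B" .
    qed simp
  qed
qed

text \<open>
  The inverse of \<open>f\<close> is Lipschitz with constant \<open>1 / \<sigma>\<close> on every ball contained in the image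
  \<open>U = f ` ball w \<rho>\<close>. Consider the largest such ball around \<open>f w\<close>: if its radius \<open>R\<close> were below \<open>\<sigma> * \<rho>\<close>, its
  preimage would lie in the compact ball of radius \<open>R / \<sigma> < \<rho>\<close>, so the point of \<open>- U\<close> nearest to \<open>f w\<close>
  would be a limit of points of a compact subset of \<open>U\<close>, hence a point of \<open>U\<close>.
\<close>

lemma conformal_image_contains_ball:
  fixes f :: "'a::euclidean_space \<Rightarrow> 'a"
  assumes V: "open V" and f: "inj_on f V" "conformal_on V f"
    and w: "ball w \<rho> \<subseteq> V" "\<rho> > 0" and \<sigma>: "\<sigma> > 0" "\<And>x. x \<in> V \<Longrightarrow> \<sigma> \<le> deriv_norm f x"
  shows "ball (f w) (\<sigma> * \<rho>) \<subseteq> f ` ball w \<rho>"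
proof -
  define U where "U = f ` ball w \<rho>"
  define g where "g = inv_into V f"
  have cont: "continuous_on V f" using f(2) by (rule conformal_on_continuous)
  have openU: "open U"
    unfolding U_def using cont f(1) w(1)
    by (intro invariance_of_domain) (auto intro: continuous_on_subset inj_on_subset)
  have wV: "w \<in> V" using w by auto
  have gf: "g (f x) = x" if "x \<in> V" for x using that f(1) by (simp add: g_def)
  have Dg: "\<exists>D. (g has_derivative D) (at (f x)) \<and> onorm D \<le> 1 / \<sigma>" if x: "x \<in> V" for x
  proof -
    let ?D = "frechet_derivative f (at x)"
    have D: "(f has_derivative ?D) (at x)" "\<And>v. norm (?D v) = deriv_norm f x * norm v"
      using conformal_onD[OF f(2) x] by auto
    have lin: "linear ?D" using D(1) by (rule has_derivative_linear)
    have "v = 0" if "?D v = 0" for v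
      using D(2)[of v] that conformal_onD(3)[OF f(2) x] by simp
    then have "inj ?D"
      using lin by (simp add: linear_injective_0)
    then obtain E where E: "linear E" "\<And>v. ?D (E v) = v"
      using linear_injective_isomorphism[OF lin] by blast
    have "(g has_derivative E) (at (f x))"
      using D(1) E(2) gf by (intro has_derivative_inverse_strong[OF V x cont]) auto
    moreover have "onorm E \<le> 1 / \<sigma>"
    proof (rule onorm_bound)
      fix v
      have "\<sigma> * norm (E v) \<le> deriv_norm f x * norm (E v)"
        using \<sigma>(2)[OF x] by (intro mult_right_mono) auto
      also have "\<dots> = norm v" using D(2)[of "E v"] E(2) by simp
      finally show "norm (E v) \<le> 1 / \<sigma> * norm v" using \<sigma>(1) by (simp add: field_simps)
    qed (use \<sigma> in auto)
    ultimately show ?thesis by blast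
  qed
  show ?thesis
  proof (cases "- U = {}")
    case True
    then show ?thesis by (auto simp: U_def)
  next
    case False
    obtain z where z: "z \<in> - U" "infdist (f w) (- U) = dist (f w) z"
      using infdist_attains_inf[of "- U" "f w"] openU False by (metis closed_Compl)
    define R where "R = dist (f w) z"
    have sub: "ball (f w) R \<subseteq> U"
    proof
      fix y assume "y \<in> ball (f w) R"
      then show "y \<in> U"
        using infdist_le[of y "- U" "f w"] z(2) by (fastforce simp: R_def)
    qed
    have DU: "(g has_derivative frechet_derivative g (at u)) (at u within ball (f w) R)"
      "onorm (frechet_derivative g (at u)) \<le> 1 / \<sigma>" if u: "u \<in> ball (f w) R" for u
    proof -
      obtain x where x: "x \<in> V" "u = f x"
        using subsetD[OF sub u] w(1) unfolding U_def by blast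
      obtain D where D: "(g has_derivative D) (at u)" "onorm D \<le> 1 / \<sigma>"
        using Dg[OF x(1)] unfolding x(2) by blast
      show "(g has_derivative frechet_derivative g (at u)) (at u within ball (f w) R)"
        "onorm (frechet_derivative g (at u)) \<le> 1 / \<sigma>"
        using D unfolding frechet_derivative_at[OF D(1), symmetric]
        by (auto intro: has_derivative_at_withinI)
    qed
    have "f w \<in> U" using w(2) by (auto simp: U_def)
    then have "R > 0" using z(1) by (auto simp: R_def)
    have "\<sigma> * \<rho> \<le> R"
    proof (rule ccontr)
      assume "\<not> \<sigma> * \<rho> \<le> R"
      then have less: "R / \<sigma> < \<rho>" using \<sigma>(1) by (simp add: field_simps)
      have "ball (f w) R \<subseteq> f ` cball w (R / \<sigma>)"
      proof
        fix y assume y: "y \<in> ball (f w) R"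
        then obtain x where x: "x \<in> ball w \<rho>" "y = f x" using sub by (auto simp: U_def)
        then have xV: "x \<in> V" using w(1) by auto
        have "norm (g (f w) - g y) \<le> 1 / \<sigma> * norm (f w - y)"
        proof (rule differentiable_bound[OF convex_ball DU])
          show "f w \<in> ball (f w) R" "y \<in> ball (f w) R"
            using \<open>R > 0\<close> y by auto
        qed
        then have "dist w x \<le> 1 / \<sigma> * dist (f w) y"
          using x gf[OF xV] gf[OF wV] by (simp add: dist_norm)
        also have "\<dots> \<le> R / \<sigma>" using y \<sigma>(1) by (simp add: field_simps)
        finally show "y \<in> f ` cball w (R / \<sigma>)" using x by auto
      qed
      moreover have "closed (f ` cball w (R / \<sigma>))"
        using less w(1) cont
        by (intro compact_imp_closed compact_continuous_image continuous_on_subset[OF cont]) auto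
      ultimately have "closure (ball (f w) R) \<subseteq> f ` cball w (R / \<sigma>)"
        by (rule closure_minimal)
      then have "z \<in> f ` cball w (R / \<sigma>)"
        using \<open>R > 0\<close> by (auto simp: R_def)
      then have "z \<in> U" using less by (auto simp: U_def)
      with z show False by simp
    qed
    then show ?thesis using sub by (auto simp: U_def)
  qed
qed

section \<open>Balls: packing and the cone condition\<close>

text \<open>
  Compare volumes.
\<close>

lemma sum_radius_power_packing:
  fixes a :: "'i \<Rightarrow> 'a::euclidean_space"
  assumes fin: "finite I" and disj: "disjoint_family_on (\<lambda>i. ball (a i) (r i)) I"
    and sub: "\<And>i. i \<in> I \<Longrightarrow> ball (a i) (r i) \<subseteq> ball x R"
    and r: "\<And>i. i \<in> I \<Longrightarrow> 0 \<le> r i" and R: "0 \<le> R"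
  shows "(\<Sum>i\<in>I. r i ^ DIM('a)) \<le> R ^ DIM('a)"
proof -
  let ?u = "unit_ball_vol (real DIM('a))"
  have "?u * (\<Sum>i\<in>I. r i ^ DIM('a)) = (\<Sum>i\<in>I. measure lborel (ball (a i) (r i)))"
    using r by (simp add: sum_distrib_left content_ball)
  also have "\<dots> = measure lborel (\<Union>i\<in>I. ball (a i) (r i))"
    using fin disj by (intro measure_finite_Union[symmetric])
      (use emeasure_bounded_finite[OF bounded_ball] in \<open>auto simp: less_top[symmetric]\<close>)
  also have "\<dots> \<le> measure lborel (ball x R)"
    using sub fin by (intro measure_mono_fmeasurable) (use emeasure_bounded_finite[OF bounded_ball, of x R] in \<open>auto simp: fmeasurable_def\<close>)
  also have "\<dots> = ?u * R ^ DIM('a)"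
    using R by (simp add: content_ball)
  finally show ?thesis by (simp add: unit_ball_vol_pos)
qed

text \<open>
  Near any point of \<open>J\<close> the interior of \<open>J\<close> contains a ball of comparable size. Either a small ball
  around \<open>z\<close> lies in \<open>J\<close>, or the boundary comes close to \<open>z\<close>; then the cone at a nearby boundary point
  contains balls, centred on its axis, of radius proportional to the distance from the vertex.
\<close>

lemma cone_condition_inner_ball:
  fixes J :: "'a::euclidean_space set"
  assumes J: "closed J" and cone: "cone_condition J"
  obtains \<kappa> \<rho>0 where "\<kappa> > 0" "\<rho>0 > 0"
    and "\<And>z \<rho>. z \<in> J \<Longrightarrow> 0 < \<rho> \<Longrightarrow> \<rho> \<le> \<rho>0 \<Longrightarrow> \<exists>w. ball w (\<kappa> * \<rho>) \<subseteq> interior J \<inter> ball z \<rho>"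
proof -
  obtain \<alpha> l where \<alpha>: "0 < \<alpha>" "\<alpha> < pi" and l: "0 < l"
    and con: "\<And>x. x \<in> frontier J \<Longrightarrow> \<exists>v. norm v = 1 \<and> open_cone x v \<alpha> l \<subseteq> interior J"
    using cone by (auto simp: cone_condition_def)
  define c where "c = cos (\<alpha> / 2)"
  have c: "0 < c" "c < 1"
    using \<alpha> cos_monotone_0_pi[of 0 "\<alpha> / 2"] by (auto simp: c_def intro!: cos_gt_zero)
  \<comment> \<open>a ball of radius \<open>\<kappa> * s\<close> centred on the axis at distance \<open>s\<close> from the vertex stays within the
     opening angle if \<open>(1 + \<kappa>) * c < 1 - \<kappa>\<close>\<close>
  define \<kappa> where "\<kappa> = (1 - c) / 2"
  have \<kappa>: "0 < \<kappa>" "\<kappa> < 1" "(1 + \<kappa>) * c < 1 - \<kappa>"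
  proof -
    have "(1 - c) * (1 + c) < (1 - c) * 2" using c by (intro mult_strict_left_mono) auto
    then show "(1 + \<kappa>) * c < 1 - \<kappa>" by (simp add: \<kappa>_def field_simps)
  qed (use c in \<open>auto simp: \<kappa>_def\<close>)
  show thesis
  proof (rule that[of "\<kappa> / 4" l])
    fix z \<rho> assume z: "z \<in> J" and \<rho>: "0 < \<rho>" "\<rho> \<le> l"
    show "\<exists>w. ball w (\<kappa> / 4 * \<rho>) \<subseteq> interior J \<inter> ball z \<rho>"
    proof (cases "ball z (\<rho> / 4) \<subseteq> J")
      case True
      then have 1: "ball z (\<rho> / 4) \<subseteq> interior J" by (simp add: interior_maximal)
      have "\<kappa> / 4 * \<rho> \<le> \<rho> / 4" using \<kappa> \<rho> by (simp add: mult_left_le_one_le)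
      then have "ball z (\<kappa> / 4 * \<rho>) \<subseteq> ball z (\<rho> / 4)" by (rule subset_ball)
      moreover have "ball z (\<rho> / 4) \<subseteq> ball z \<rho>" using \<rho> by (intro subset_ball) auto
      ultimately show ?thesis using 1 by blast
    next
      case False
      have "z \<in> ball z (\<rho> / 4) \<inter> J" using z \<rho> by simp
      moreover have "ball z (\<rho> / 4) - J \<noteq> {}" using False by blast
      ultimately have "ball z (\<rho> / 4) \<inter> frontier J \<noteq> {}"
        using connected_Int_frontier[OF connected_ball, of z "\<rho> / 4" J] by blast
      then obtain z0 where z0: "z0 \<in> frontier J" "dist z z0 < \<rho> / 4" by auto
      obtain v where v: "norm v = 1" "open_cone z0 v \<alpha> l \<subseteq> interior J"
        using con[OF z0(1)] by blast
      define s where "s = \<rho> / 4"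
      have s: "s > 0" using \<rho> by (simp add: s_def)
      define w where "w = z0 + s *\<^sub>R v"
      have "y \<in> interior J \<inter> ball z \<rho>" if y: "y \<in> ball w (\<kappa> / 4 * \<rho>)" for y
      proof -
        define e where "e = y - w"
        have e: "norm e < \<kappa> * s" using y by (simp add: e_def s_def dist_norm norm_minus_commute)
        have y_eq: "y - z0 = s *\<^sub>R v + e" by (simp add: e_def w_def)
        have n: "norm (y - z0) < (1 + \<kappa>) * s"
          using norm_triangle_ineq[of "s *\<^sub>R v" e] e v(1) s by (simp add: y_eq algebra_simps)
        have ev: "\<bar>e \<bullet> v\<bar> < \<kappa> * s" using Cauchy_Schwarz_ineq2[of e v] v(1) e by simp
        have iv: "(y - z0) \<bullet> v = s + e \<bullet> v"
          using v(1) by (simp add: y_eq inner_add_left dot_square_norm)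
        have "norm (y - z0) * c \<le> ((1 + \<kappa>) * s) * c" using n c by (intro mult_right_mono) auto
        also have "\<dots> < (1 - \<kappa>) * s"
          using mult_strict_right_mono[OF \<kappa>(3) s] by (simp add: mult_ac)
        also have "\<dots> < (y - z0) \<bullet> v" using ev unfolding iv by (simp add: left_diff_distrib)
        finally have 1: "norm (y - z0) * c < (y - z0) \<bullet> v" .
        have k2: "(1 + \<kappa>) * s \<le> 2 * s" using \<kappa> s by (intro mult_right_mono) auto
        have "(y - z0) \<bullet> v < (1 + \<kappa>) * s" using ev unfolding iv by (simp add: distrib_right)
        also have "\<dots> \<le> 2 * s" by (rule k2)
        also have "\<dots> \<le> l" using \<rho> by (simp add: s_def)
        finally have "y \<in> open_cone z0 v \<alpha> l" using 1 by (simp add: open_cone_def c_def)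
        moreover have "dist z y < \<rho>"
        proof -
          have "dist z0 y < 2 * s" using n k2 by (simp add: dist_norm norm_minus_commute)
          then show ?thesis
            using dist_triangle[of z y z0] z0(2) \<rho> by (simp add: s_def)
        qed
        ultimately show ?thesis using v(2) by auto
      qed
      then show ?thesis by blast
    qed
  qed (use \<kappa> l in auto)
qed

section \<open>Hausdorff measure\<close>

lemma hausdorff_premeasure_antimono:
  "\<delta> \<le> \<delta>' \<Longrightarrow> hausdorff_premeasure s \<delta>' A \<le> hausdorff_premeasure s \<delta> A"
  unfolding hausdorff_premeasure_def by (rule INF_superset_mono) (auto intro: order_trans)

lemma hausdorff_measure_eq_0_iff:
  "hausdorff_measure s A = 0 \<longleftrightarrow> (\<forall>\<delta>>0. hausdorff_premeasure s \<delta> A = 0)"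
  by (auto simp: hausdorff_measure_def bot_ennreal[symmetric] SUP_bot_conv)

lemma diam_pow_pos: "t \<noteq> 0 \<Longrightarrow> diam_pow t U = ennreal (diameter U powr t)"
  by (simp add: diam_pow_def)

lemma diam_pow_antimono:
  assumes "0 \<le> s" "s \<le> t" "0 < t" "bounded U" "diameter U \<le> 1"
  shows "diam_pow t U \<le> diam_pow s U"
proof (cases "U = {}")
  case False
  have d: "0 \<le> diameter U" using assms(4) by (rule diameter_ge_0)
  show ?thesis
  proof (cases "s = 0")
    case True
    then show ?thesis
      using False d assms powr_le1[of t "diameter U"] by (simp add: diam_pow_def)
  next
    case False
    then show ?thesis
      using d assms powr_mono'[of s t "diameter U"] by (simp add: diam_pow_def ennreal_leI)
  qed
qed (simp add: diam_pow_def)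

lemma hausdorff_measure_eq_0_mono:
  assumes "0 \<le> s" "s \<le> t" "0 < t" "hausdorff_measure s A = 0"
  shows "hausdorff_measure t A = 0"
  unfolding hausdorff_measure_eq_0_iff
proof (intro allI impI)
  fix \<delta> :: real assume \<delta>: "\<delta> > 0"
  let ?\<delta> = "min \<delta> 1"
  have "hausdorff_premeasure t \<delta> A \<le> hausdorff_premeasure t ?\<delta> A"
    by (rule hausdorff_premeasure_antimono) simp
  also have "\<dots> \<le> hausdorff_premeasure s ?\<delta> A"
    unfolding hausdorff_premeasure_def
  proof (rule INF_mono)
    fix U :: "nat \<Rightarrow> 'a set"
    assume U: "U \<in> {U. A \<subseteq> (\<Union>i. U i) \<and> (\<forall>i. bounded (U i) \<and> diameter (U i) \<le> ?\<delta>)}"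
    then have "(\<Sum>i. diam_pow t (U i)) \<le> (\<Sum>i. diam_pow s (U i))"
      using assms by (intro suminf_le diam_pow_antimono) auto
    then show "\<exists>V\<in>{U. A \<subseteq> (\<Union>i. U i) \<and> (\<forall>i. bounded (U i) \<and> diameter (U i) \<le> ?\<delta>)}.
        (\<Sum>i. diam_pow t (V i)) \<le> (\<Sum>i. diam_pow s (U i))"
      using U by blast
  qed
  also have "\<dots> = 0"
    using assms(4) \<delta> by (simp add: hausdorff_measure_eq_0_iff)
  finally show "hausdorff_premeasure t \<delta> A = 0" by simp
qed

text \<open>
  Covers indexed by a countable set instead of \<open>nat\<close>; the words of a fixed length will be the index set.
\<close>

lemma hausdorff_measure_eq_0I:
  assumes t: "t > 0"
    and cover: "\<And>\<delta> \<epsilon>. \<delta> > 0 \<Longrightarrow> \<epsilon> > 0 \<Longrightarrow> \<exists>W::'i set. countable W \<and> A \<subseteq> (\<Union>u\<in>W. P u) \<and>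
      (\<forall>u\<in>W. bounded (P u) \<and> diameter (P u) \<le> \<delta>) \<and>
      (\<forall>F. finite F \<longrightarrow> F \<subseteq> W \<longrightarrow> (\<Sum>u\<in>F. diameter (P u) powr t) \<le> \<epsilon>)"
  shows "hausdorff_measure t A = 0"
  unfolding hausdorff_measure_eq_0_iff
proof (intro allI impI)
  fix \<delta> :: real assume \<delta>: "\<delta> > 0"
  have eps: "hausdorff_premeasure t \<delta> A \<le> 0 + ennreal \<epsilon>" if \<epsilon>: "\<epsilon> > 0" for \<epsilon>
  proof -
    obtain W :: "'i set" where W: "countable W" "A \<subseteq> (\<Union>u\<in>W. P u)"
      "\<And>u. u \<in> W \<Longrightarrow> bounded (P u) \<and> diameter (P u) \<le> \<delta>"
      "\<And>F. finite F \<Longrightarrow> F \<subseteq> W \<Longrightarrow> (\<Sum>u\<in>F. diameter (P u) powr t) \<le> \<epsilon>"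
      using cover[OF \<delta> \<epsilon>] by blast
    define I where "I = to_nat_on W ` W"
    define h where "h = inv_into W (to_nat_on W)"
    have inj: "inj_on (to_nat_on W) W" using W(1) by (rule inj_on_to_nat_on)
    have h: "h i \<in> W" if "i \<in> I" for i
      using that by (auto simp: h_def I_def intro: inv_into_into)
    have h_inj: "inj_on h I"
      unfolding h_def I_def by (rule inj_on_inv_into) simp
    have h_surj: "h ` I = W"
      unfolding h_def I_def using inj by (simp add: image_inv_into_cancel inv_into_image_cancel)
    define U where "U i = (if i \<in> I then P (h i) else {})" for i
    have "A \<subseteq> (\<Union>i. U i)"
    proof
      fix x assume "x \<in> A"
      then obtain u where "u \<in> W" "x \<in> P u" using W(2) by blast
      then obtain i where "i \<in> I" "x \<in> P (h i)" using h_surj by blast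
      then show "x \<in> (\<Union>i. U i)" by (auto simp: U_def)
    qed
    moreover have "bounded (U i) \<and> diameter (U i) \<le> \<delta>" for i
      using W(3) h \<delta> by (auto simp: U_def)
    ultimately have "hausdorff_premeasure t \<delta> A \<le> (\<Sum>i. diam_pow t (U i))"
      unfolding hausdorff_premeasure_def by (intro INF_lower) auto
    also have "\<dots> \<le> ennreal \<epsilon>"
    proof (rule suminf_le_const)
      fix n
      have "(\<Sum>i<n. diam_pow t (U i)) = (\<Sum>i\<in>{..<n} \<inter> I. ennreal (diameter (P (h i)) powr t))"
        using t by (intro sum.mono_neutral_cong_right) (auto simp: U_def diam_pow_def)
      also have "\<dots> = ennreal (\<Sum>i\<in>{..<n} \<inter> I. diameter (P (h i)) powr t)"
        by (rule sum_ennreal) simp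
      also have "(\<Sum>i\<in>{..<n} \<inter> I. diameter (P (h i)) powr t) =
          (\<Sum>u\<in>h ` ({..<n} \<inter> I). diameter (P u) powr t)"
        using h_inj by (subst sum.reindex) (auto intro: inj_on_subset)
      also have "\<dots> \<le> \<epsilon>" using h by (intro W(4)) auto
      finally show "(\<Sum>i<n. diam_pow t (U i)) \<le> ennreal \<epsilon>"
        by (simp add: ennreal_leI)
    qed simp
    finally show ?thesis by simp
  qed
  have "hausdorff_premeasure t \<delta> A \<le> 0"
    by (rule ennreal_le_epsilon) (rule eps)
  then show "hausdorff_premeasure t \<delta> A = 0" by simp
qed

text \<open>
  Replacing the sets of a cover by balls costs an arbitrarily small amount. The radius must exceed the
  diameter, which may be 0, so it is found by continuity of \<open>r powr t\<close> rather than as a multiple of the diameter.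
\<close>

lemma ball_cover_diameter_powr:
  fixes U :: "'a::metric_space set"
  assumes U: "bounded U" "diameter U \<le> 1 / 2" and t: "t > 0" and e: "e > 0"
  shows "\<exists>x r. 0 < r \<and> r < 1 \<and> U \<subseteq> ball x r \<and> r powr t \<le> diameter U powr t + e"
proof -
  let ?d = "diameter U"
  have d: "0 \<le> ?d" using U(1) by (rule diameter_ge_0)
  have "((\<lambda>r. r powr t) \<longlongrightarrow> ?d powr t) (at_right ?d)"
  proof (rule tendsto_powr2[OF tendsto_ident_at tendsto_const _ t])
    show "\<forall>\<^sub>F r in at_right ?d. 0 \<le> r"
      using eventually_at_right_less[of ?d] by eventually_elim (use d in simp)
  qed
  then have "\<forall>\<^sub>F r in at_right ?d. r powr t < ?d powr t + e"
    using e by (intro order_tendstoD) auto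
  moreover have "\<forall>\<^sub>F r in at_right ?d. r < 1"
    using U(2) by (intro order_tendstoD(2)[OF tendsto_ident_at]) auto
  moreover have "\<forall>\<^sub>F r in at_right ?d. ?d < r"
    by (rule eventually_at_right_less)
  ultimately have "\<forall>\<^sub>F r in at_right ?d. r powr t < ?d powr t + e \<and> r < 1 \<and> ?d < r"
    by eventually_elim simp
  then obtain r where r: "r powr t < ?d powr t + e" "r < 1" "?d < r"
    using eventually_happens'[OF trivial_limit_at_right_real] by blast
  have "\<exists>x. U \<subseteq> ball x r"
  proof (cases "U = {}")
    case False
    then obtain x where "x \<in> U" by blast
    then have "U \<subseteq> ball x r"
      using diameter_bounded_bound[OF U(1)] r(3) by (meson le_less_trans mem_ball subsetI)
    then show ?thesis ..
  qed simp
  then show ?thesis using r d by (meson le_less_trans less_imp_le)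
qed

lemma sum_UN_le:
  fixes w :: "'i \<Rightarrow> real"
  assumes "finite F" "\<And>i. i \<in> F \<Longrightarrow> finite (H i)" "\<And>i u. i \<in> F \<Longrightarrow> u \<in> H i \<Longrightarrow> 0 \<le> w u"
  shows "(\<Sum>u\<in>(\<Union>i\<in>F. H i). w u) \<le> (\<Sum>i\<in>F. \<Sum>u\<in>H i. w u)"
  using assms
proof (induction F rule: finite_induct)
  case (insert i F)
  have "(\<Sum>u\<in>(\<Union>i\<in>insert i F. H i). w u) \<le> (\<Sum>u\<in>H i. w u) + (\<Sum>u\<in>(\<Union>i\<in>F. H i). w u)"
  proof -
    have "(\<Sum>u\<in>H i \<inter> (\<Union>i\<in>F. H i). w u) \<ge> 0"
      using insert.prems by (intro sum_nonneg) auto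
    then show ?thesis
      using insert.hyps insert.prems sum.union_inter[of "H i" "\<Union>i\<in>F. H i" w] by auto
  qed
  also have "\<dots> \<le> (\<Sum>u\<in>H i. w u) + (\<Sum>i\<in>F. \<Sum>u\<in>H i. w u)"
    using insert by auto
  finally show ?case using insert.hyps by simp
qed simp

text \<open>
  The mass distribution principle without a measure: instead of a limiting measure on \<open>\<Inter>n. K n\<close>, each level
  \<open>n\<close> carries a probability vector on its pieces. A cover of the compact intersection by open balls covers
  some \<open>K n\<close> and, by compactness, finitely many of the balls suffice. All their radii are then admissible at a
  common later level, where the total mass 1 is at most \<open>Q\<close> times the sum of the \<open>r i powr t\<close>.
\<close>

lemma mass_distribution:
  fixes K :: "nat \<Rightarrow> 'a::heine_borel set" and P :: "'i \<Rightarrow> 'a set"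
  assumes t: "t > 0"
    and K: "\<And>n. compact (K n)" "\<And>m n. m \<le> n \<Longrightarrow> K n \<subseteq> K m" "(\<Inter>n. K n) \<subseteq> A"
    and W: "\<And>n. finite (W n)" "\<And>n u. u \<in> W n \<Longrightarrow> P u \<noteq> {} \<and> P u \<subseteq> K n"
    and w: "\<And>n u. u \<in> W n \<Longrightarrow> 0 \<le> w n u" "\<And>n. (\<Sum>u\<in>W n. w n u) = 1"
    and Q: "Q \<ge> 0"
    and ball: "\<And>r. 0 < r \<Longrightarrow> r < 1 \<Longrightarrow> \<exists>N. \<forall>n\<ge>N. \<forall>x.
      (\<Sum>u\<in>{u \<in> W n. P u \<inter> ball x r \<noteq> {}}. w n u) \<le> Q * r powr t"
  shows "hausdorff_measure t A \<noteq> 0"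
proof
  assume "hausdorff_measure t A = 0"
  then have z: "hausdorff_premeasure t (1 / 2) A = 0"
    by (simp add: hausdorff_measure_eq_0_iff)
  define \<epsilon> where "\<epsilon> = 1 / (4 * (Q + 1))"
  have \<epsilon>: "\<epsilon> > 0" using Q by (simp add: \<epsilon>_def)
  have "hausdorff_premeasure t (1 / 2) A < ennreal \<epsilon>" using z \<epsilon> by simp
  then obtain U where U: "A \<subseteq> (\<Union>i::nat. U i)" "\<And>i. bounded (U i)" "\<And>i. diameter (U i) \<le> 1 / 2"
    "(\<Sum>i. diam_pow t (U i)) < ennreal \<epsilon>"
    unfolding hausdorff_premeasure_def INF_less_iff by auto
  have "\<exists>x r. 0 < r \<and> r < 1 \<and> U i \<subseteq> ball x r \<and>
      r powr t \<le> diameter (U i) powr t + \<epsilon> * (1 / 2) ^ Suc i" for i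
    using \<epsilon> by (intro ball_cover_diameter_powr U t) simp
  then obtain x r where xr: "\<And>i. 0 < r i" "\<And>i. r i < 1" "\<And>i. U i \<subseteq> ball (x i) (r i)"
    "\<And>i. r i powr t \<le> diameter (U i) powr t + \<epsilon> * (1 / 2) ^ Suc i"
    by metis
  have small: "(\<Sum>i\<in>F. r i powr t) \<le> 2 * \<epsilon>" if F: "finite F" for F
  proof -
    have "(\<Sum>i\<in>F. r i powr t) \<le> (\<Sum>i\<in>F. diameter (U i) powr t) + \<epsilon> * (\<Sum>i\<in>F. (1 / 2) ^ Suc i)"
      unfolding sum_distrib_left sum.distrib[symmetric] by (rule sum_mono) (rule xr(4))
    moreover have "(\<Sum>i\<in>F. diameter (U i) powr t) \<le> \<epsilon>"
    proof -
      have "ennreal (\<Sum>i\<in>F. diameter (U i) powr t) = (\<Sum>i\<in>F. diam_pow t (U i))"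
        using t by (simp add: diam_pow_pos sum_ennreal)
      also have "\<dots> \<le> (\<Sum>i. diam_pow t (U i))"
        using F by (intro sum_le_suminf) auto
      also have "\<dots> \<le> ennreal \<epsilon>" using U(4) by simp
      finally show ?thesis using \<epsilon> by (simp add: ennreal_le_iff)
    qed
    moreover have "(\<Sum>i\<in>F. (1 / 2 :: real) ^ Suc i) \<le> 1"
      using sum_le_suminf[OF sums_summable[OF power_half_series] F]
        sums_unique[OF power_half_series] by simp
    ultimately show ?thesis using \<epsilon>
      by (smt (verit) mult_left_le)
  qed
  let ?O = "\<Union>i. ball (x i) (r i)"
  obtain n0 where n0: "K n0 \<subseteq> ?O"
  proof -
    have "\<exists>n. K n - ?O = {}"
    proof (rule ccontr)
      assume "\<not> ?thesis"
      then have ne: "K n - ?O \<noteq> {}" for n by simp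
      have cp: "compact (K n - ?O)" for n
        using K(1) by (auto intro!: compact_diff)
      have dec: "K n - ?O \<subseteq> K m - ?O" if "m \<le> n" for m n using K(2)[OF that] by blast
      have "(\<Inter>n. K n - ?O) \<noteq> {}"
        by (rule compact_nest[where F = "\<lambda>n. K n - ?O", OF cp ne dec])
      moreover have "(\<Inter>n. K n) \<subseteq> ?O"
        using K(3) U(1) by (rule subset_trans[OF subset_trans]) (intro UN_mono xr(3) subset_refl)
      ultimately show False by auto
    qed
    then show ?thesis using that by blast
  qed
  obtain F where F: "finite F" "K n0 \<subseteq> (\<Union>i\<in>F. ball (x i) (r i))"
    using compactE_image[OF K(1), of UNIV "\<lambda>i. ball (x i) (r i)" n0] n0 by auto
  have "\<exists>N. \<forall>n\<ge>N. \<forall>x. (\<Sum>u\<in>{u \<in> W n. P u \<inter> ball x (r i) \<noteq> {}}. w n u) \<le> Q * r i powr t" for i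
    by (rule ball[OF xr(1,2)])
  then obtain N where N: "\<And>i n x. n \<ge> N i \<Longrightarrow>
      (\<Sum>u\<in>{u \<in> W n. P u \<inter> ball x (r i) \<noteq> {}}. w n u) \<le> Q * r i powr t"
    by metis
  define n where "n = Max (insert n0 (N ` F))"
  have n: "n0 \<le> n" "\<And>i. i \<in> F \<Longrightarrow> N i \<le> n" using F(1) by (auto simp: n_def)
  let ?H = "\<lambda>i. {u \<in> W n. P u \<inter> ball (x i) (r i) \<noteq> {}}"
  have sub: "W n \<subseteq> (\<Union>i\<in>F. ?H i)"
  proof
    fix u assume u: "u \<in> W n"
    then obtain y where "y \<in> P u" "y \<in> K n0" using W(2) K(2)[OF n(1)] by blast
    then show "u \<in> (\<Union>i\<in>F. ?H i)" using F(2) u by blast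
  qed
  have "1 = (\<Sum>u\<in>W n. w n u)" using w(2) by simp
  also have "\<dots> \<le> (\<Sum>u\<in>(\<Union>i\<in>F. ?H i). w n u)"
    using sub F(1) W(1) w(1) by (intro sum_mono2) auto
  also have "\<dots> \<le> (\<Sum>i\<in>F. \<Sum>u\<in>?H i. w n u)"
    using F(1) W(1) w(1) by (intro sum_UN_le) auto
  also have "\<dots> \<le> (\<Sum>i\<in>F. Q * r i powr t)"
    using N n by (intro sum_mono) auto
  also have "\<dots> \<le> Q * (2 * \<epsilon>)"
    unfolding sum_distrib_left[symmetric] using small[OF F(1)] Q by (rule mult_left_mono)
  also have "\<dots> < 1" using Q by (simp add: \<epsilon>_def field_simps)
  finally show False by simp
qed

section \<open>Non-autonomous conformal systems\<close>

text \<open>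
  The data of a conformal system with the open set condition and the cone condition, with its constants
  \<open>V\<close>, \<open>c\<close>, \<open>C\<close> fixed. A word of length \<open>n\<close> starting at level 1 is a list \<open>u\<close> with \<open>set u \<subseteq> {1..}\<close>, which
  spares the level arithmetic of \<^const>\<open>words\<close>.
\<close>

locale conformal_ifs =
  fixes J :: "'a::euclidean_space set" and \<phi> :: "nat \<Rightarrow> nat \<Rightarrow> 'a \<Rightarrow> 'a"
    and Jw :: "nat list \<Rightarrow> 'a set" and V :: "'a set" and c C :: real
  assumes compact_J: "compact J" and interior_J: "interior J \<noteq> {}"
    and maps_J: "\<And>k i. k \<ge> 1 \<Longrightarrow> i \<ge> 1 \<Longrightarrow> \<phi> k i ` J \<subseteq> J"
    and c: "0 < c" "c < 1"
    and contraction: "\<And>k i x y. k \<ge> 1 \<Longrightarrow> i \<ge> 1 \<Longrightarrow> x \<in> J \<Longrightarrow> y \<in> J \<Longrightarrow>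
      norm (\<phi> k i x - \<phi> k i y) \<le> c * norm (x - y)"
    and Jw_Nil: "Jw [] = J"
    and Jw_snoc: "\<And>u i. set u \<subseteq> {1..} \<Longrightarrow> i \<ge> 1 \<Longrightarrow> Jw (u @ [i]) \<subseteq> Jw u"
    and Jw_image: "\<And>u. set u \<subseteq> {1..} \<Longrightarrow> \<exists>\<omega>. Jw u = (\<lambda>x. word_map \<phi> 1 u x + \<omega>) ` J"
    and V: "open V" "connected V" "J \<subseteq> V"
    and diffeo: "\<And>k i. k \<ge> 1 \<Longrightarrow> i \<ge> 1 \<Longrightarrow> conformal_diffeo_into V (\<phi> k i)"
    and C: "C \<ge> 1"
    and distortion: "\<And>l u x y. l \<ge> 1 \<Longrightarrow> u \<noteq> [] \<Longrightarrow> set u \<subseteq> {1..} \<Longrightarrow> x \<in> V \<Longrightarrow> y \<in> V \<Longrightarrow>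
      deriv_norm (word_map \<phi> l u) x \<le> C * deriv_norm (word_map \<phi> l u) y"
    and osc: "\<And>u i j. set u \<subseteq> {1..} \<Longrightarrow> i \<ge> 1 \<Longrightarrow> j \<ge> 1 \<Longrightarrow> i \<noteq> j \<Longrightarrow>
      interior (Jw (u @ [i])) \<inter> interior (Jw (u @ [j])) = {}"
    and cone: "cone_condition J"
begin

text \<open>
  The number written \<open>\<parallel>D\<phi>\<^sub>u\<parallel>\<close> on paper, for a word whose first letter belongs to level \<open>l\<close>.
\<close>

definition q :: "nat \<Rightarrow> nat list \<Rightarrow> real" where
  "q l u = sup_deriv_norm J (word_map \<phi> l u)"

lemma word_map_append:
  "word_map \<phi> l (u @ v) = word_map \<phi> l u \<circ> word_map \<phi> (l + length u) v"
  by (induction u arbitrary: l) (auto simp: comp_assoc)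

lemma word_map_V:
  assumes "l \<ge> 1" "set u \<subseteq> {1..}"
  shows "conformal_on V (word_map \<phi> l u) \<and> word_map \<phi> l u ` V \<subseteq> V \<and> inj_on (word_map \<phi> l u) V"
  using assms
proof (induction u arbitrary: l)
  case Nil
  then show ?case
    unfolding word_map.simps by (intro conjI conformal_on_id(1)) auto
next
  case (Cons i u)
  have 1: "conformal_on V (word_map \<phi> (Suc l) u)" "word_map \<phi> (Suc l) u ` V \<subseteq> V"
    "inj_on (word_map \<phi> (Suc l) u) V"
    using Cons.IH[of "Suc l"] Cons.prems by auto
  have "conformal_diffeo_into V (\<phi> l i)" using diffeo Cons.prems by auto
  then have 2: "conformal_on V (\<phi> l i)" "\<phi> l i ` V \<subseteq> V" "inj_on (\<phi> l i) V"
    by (auto simp: conformal_diffeo_into_def conformal_on_def C1_on_def differentiable_def)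
  have "inj_on (\<phi> l i \<circ> word_map \<phi> (Suc l) u) V"
    using 1 2 by (meson comp_inj_on inj_on_subset)
  moreover have "(\<phi> l i \<circ> word_map \<phi> (Suc l) u) ` V \<subseteq> V"
    using 1 2 by (auto simp: image_subset_iff)
  ultimately show ?case
    unfolding word_map.simps using conformal_on_compose(1)[OF 2(1) 1(1,2)] by blast
qed

lemma word_map_J:
  assumes "l \<ge> 1" "set u \<subseteq> {1..}"
  shows "word_map \<phi> l u ` J \<subseteq> J"
  using assms
proof (induction u arbitrary: l)
  case (Cons i u)
  have "word_map \<phi> (Suc l) u ` J \<subseteq> J" "\<phi> l i ` J \<subseteq> J"
    using Cons.IH[of "Suc l"] Cons.prems maps_J by auto
  then show ?case by (auto simp: image_subset_iff)
qed simp

lemma word_map_contraction: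
  assumes "l \<ge> 1" "set u \<subseteq> {1..}" "x \<in> J" "y \<in> J"
  shows "norm (word_map \<phi> l u x - word_map \<phi> l u y) \<le> c ^ length u * norm (x - y)"
  using assms
proof (induction u arbitrary: l)
  case (Cons i u)
  let ?f = "word_map \<phi> (Suc l) u"
  have J: "?f x \<in> J" "?f y \<in> J" using word_map_J[of "Suc l" u] Cons.prems by auto
  have "norm (\<phi> l i (?f x) - \<phi> l i (?f y)) \<le> c * norm (?f x - ?f y)"
    using contraction J Cons.prems by auto
  also have "\<dots> \<le> c * (c ^ length u * norm (x - y))"
    using Cons.IH[of "Suc l"] Cons.prems c by (intro mult_left_mono) auto
  finally show ?case by (simp add: mult.assoc)
qed simp

lemma distortion':
  assumes "l \<ge> 1" "set u \<subseteq> {1..}" "x \<in> V" "y \<in> V"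
  shows "deriv_norm (word_map \<phi> l u) x \<le> C * deriv_norm (word_map \<phi> l u) y"
proof (cases "u = []")
  case True
  then show ?thesis using C by (simp add: conformal_on_id(2))
qed (use distortion assms in auto)

lemma J_nonempty: "J \<noteq> {}" using interior_J interior_subset by blast

text \<open>
  By bounded distortion, the supremum over \<open>J\<close> and the value at any point of \<open>V\<close> agree up to the factor \<open>C\<close>.
\<close>

lemma deriv_norm_q:
  assumes u: "l \<ge> 1" "set u \<subseteq> {1..}"
  shows "x \<in> J \<Longrightarrow> deriv_norm (word_map \<phi> l u) x \<le> q l u"
    and "x \<in> V \<Longrightarrow> q l u \<le> C * deriv_norm (word_map \<phi> l u) x"
    and "x \<in> V \<Longrightarrow> deriv_norm (word_map \<phi> l u) x \<le> C * q l u"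
    and "q l u > 0"
proof -
  obtain x0 where x0: "x0 \<in> J" using J_nonempty by blast
  then have x0V: "x0 \<in> V" using V by auto
  have bdd: "bdd_above ((\<lambda>x. deriv_norm (word_map \<phi> l u) x) ` J)"
    using distortion'[OF u _ x0V] V(3)
    by (intro bdd_aboveI2[of _ _ "C * deriv_norm (word_map \<phi> l u) x0"]) auto
  show 1: "deriv_norm (word_map \<phi> l u) x \<le> q l u" if "x \<in> J" for x
    unfolding q_def sup_deriv_norm_def using bdd that by (intro cSUP_upper)
  show "q l u \<le> C * deriv_norm (word_map \<phi> l u) x" if "x \<in> V"
    unfolding q_def sup_deriv_norm_def using that J_nonempty V(3)
    by (intro cSUP_least distortion' u) auto
  show "deriv_norm (word_map \<phi> l u) x \<le> C * q l u" if "x \<in> V"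
  proof -
    have "deriv_norm (word_map \<phi> l u) x \<le> C * deriv_norm (word_map \<phi> l u) x0"
      using distortion'[OF u that x0V] .
    also have "\<dots> \<le> C * q l u" using 1[OF x0] C by (intro mult_left_mono) auto
    finally show ?thesis .
  qed
  show "q l u > 0"
    using 1[OF x0] conformal_onD(3)[of V "word_map \<phi> l u" x0] word_map_V[OF u] x0V by auto
qed

lemma q_Nil: "q l [] = 1"
  using J_nonempty by (simp add: q_def sup_deriv_norm_def conformal_on_id(2))

text \<open>
  At an interior point of \<open>J\<close> the contraction bounds the derivative by \<open>c ^ length u\<close>; distortion
  carries the bound to all of \<open>J\<close>.
\<close>

lemma q_le_power:
  assumes u: "l \<ge> 1" "set u \<subseteq> {1..}"
  shows "q l u \<le> C * c ^ length u"
proof -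
  obtain x where x: "x \<in> interior J" using interior_J by blast
  then have xJ: "x \<in> J" using interior_subset by blast
  have "deriv_norm (word_map \<phi> l u) x \<le> c ^ length u"
  proof (rule deriv_norm_le_lipschitz[of V _ _ "interior J"])
    show "norm (word_map \<phi> l u y - word_map \<phi> l u x) \<le> c ^ length u * norm (y - x)"
      if "y \<in> interior J" for y
      using word_map_contraction[OF u _ xJ] that interior_subset by blast
  qed (use x xJ V word_map_V[OF u] in auto)
  then have "C * deriv_norm (word_map \<phi> l u) x \<le> C * c ^ length u"
    using C by (intro mult_left_mono) auto
  then show ?thesis using deriv_norm_q(2)[OF u, of x] xJ V by force
qed

text \<open>
  The chain rule makes \<open>q\<close> submultiplicative, and bounded distortion makes it supermultiplicative up to \<open>C\<close>.
\<close>

lemma q_append: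
  assumes u: "l \<ge> 1" "set u \<subseteq> {1..}" "set v \<subseteq> {1..}"
  shows "q l (u @ v) \<le> q l u * q (l + length u) v"
    and "q l u * q (l + length u) v \<le> C * q l (u @ v)"
proof -
  let ?f = "word_map \<phi> l u" and ?g = "word_map \<phi> (l + length u) v"
  have l': "l + length u \<ge> 1" using u by simp
  have uv: "set (u @ v) \<subseteq> {1..}" using u by simp
  have D: "deriv_norm (word_map \<phi> l (u @ v)) x = deriv_norm ?f (?g x) * deriv_norm ?g x"
    if "x \<in> J" for x
    unfolding word_map_append
    using that V word_map_V[OF u(1,2)] word_map_V[OF l' u(3)]
    by (intro conformal_on_compose(2)[of V]) auto
  have gJ: "?g x \<in> J" if "x \<in> J" for x using word_map_J[OF l' u(3)] that by auto
  note f = deriv_norm_q[OF u(1,2)] and g = deriv_norm_q[OF l' u(3)] and fg = deriv_norm_q[OF u(1) uv]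
  show "q l (u @ v) \<le> q l u * q (l + length u) v"
    unfolding q_def[of l "u @ v"] sup_deriv_norm_def
  proof (rule cSUP_least[OF J_nonempty])
    fix x assume x: "x \<in> J"
    have "deriv_norm ?g x \<ge> 0"
      using conformal_onD(3)[of V ?g x] word_map_V[OF l' u(3)] x V by force
    then show "deriv_norm (word_map \<phi> l (u @ v)) x \<le> q l u * q (l + length u) v"
      unfolding D[OF x] using f(1)[OF gJ[OF x]] g(1)[OF x] f(4) by (intro mult_mono) auto
  qed
  have "q (l + length u) v \<le> C * q l (u @ v) / q l u"
    unfolding q_def[of "l + length u" v] sup_deriv_norm_def
  proof (rule cSUP_least[OF J_nonempty])
    fix x assume x: "x \<in> J"
    have pos: "deriv_norm ?g x \<ge> 0"
      using conformal_onD(3)[of V ?g x] word_map_V[OF l' u(3)] x V by force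
    have "q l u * deriv_norm ?g x \<le> (C * deriv_norm ?f (?g x)) * deriv_norm ?g x"
      using f(2)[of "?g x"] gJ[OF x] V pos by (intro mult_right_mono) auto
    also have "\<dots> = C * deriv_norm (word_map \<phi> l (u @ v)) x" by (simp add: D[OF x])
    also have "\<dots> \<le> C * q l (u @ v)" using fg(1)[OF x] C by (intro mult_left_mono) auto
    finally show "deriv_norm ?g x \<le> C * q l (u @ v) / q l u"
      using f(4) by (simp add: pos_le_divide_eq mult.commute)
  qed
  then show "q l u * q (l + length u) v \<le> C * q l (u @ v)"
    using f(4) by (simp add: pos_le_divide_eq mult.commute)
qed

lemma Jw_nonempty_compact:
  assumes "set u \<subseteq> {1..}"
  shows "Jw u \<noteq> {}" "compact (Jw u)"
proof -
  obtain \<omega> where \<omega>: "Jw u = (\<lambda>x. word_map \<phi> 1 u x + \<omega>) ` J" using Jw_image assms by blast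
  show "Jw u \<noteq> {}" using \<omega> J_nonempty by simp
  have "continuous_on J (word_map \<phi> 1 u)"
    using word_map_V[of 1 u] assms V by (auto intro: continuous_on_subset conformal_on_continuous)
  then show "compact (Jw u)"
    unfolding \<omega> using compact_J by (intro compact_continuous_image continuous_intros)
qed

lemma diameter_Jw:
  obtains L where "L > 0" "\<And>u. set u \<subseteq> {1..} \<Longrightarrow> diameter (Jw u) \<le> L * q 1 u"
proof -
  obtain L where L: "L > 0" "\<And>f B x y. conformal_on V f \<Longrightarrow> (\<And>z. z \<in> V \<Longrightarrow> deriv_norm f z \<le> B) \<Longrightarrow>
      x \<in> J \<Longrightarrow> y \<in> J \<Longrightarrow> dist (f x) (f y) \<le> L * B"
    using compact_chain_bound[OF V(1,2) compact_J V(3)] by blast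
  show thesis
  proof (rule that[of "L * C"])
    fix u :: "nat list" assume u: "set u \<subseteq> {1..}"
    obtain \<omega> where \<omega>: "Jw u = (\<lambda>x. word_map \<phi> 1 u x + \<omega>) ` J" using Jw_image u by blast
    have "dist (word_map \<phi> 1 u x) (word_map \<phi> 1 u y) \<le> L * (C * q 1 u)" if "x \<in> J" "y \<in> J" for x y
      using word_map_V[of 1 u] u deriv_norm_q(3)[of 1 u] that by (intro L(2)) auto
    then show "diameter (Jw u) \<le> L * C * q 1 u"
      using Jw_nonempty_compact[OF u]
      by (intro diameter_le) (auto simp: \<omega> dist_norm mult.assoc)
  qed (use L C in auto)
qed

lemma Jw_append: "set (u @ v) \<subseteq> {1..} \<Longrightarrow> Jw (u @ v) \<subseteq> Jw u"
proof (induction v rule: rev_induct)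
  case (snoc i v)
  have "Jw ((u @ v) @ [i]) \<subseteq> Jw (u @ v)" using snoc.prems by (intro Jw_snoc) auto
  then show ?case using snoc by auto
qed simp

text \<open>
  The open set condition compares siblings only. The prefixes of two words that end with the first letter where
  they differ are siblings, and the pieces of the words lie in those of the prefixes.
\<close>

lemma interior_Jw_disjoint:
  assumes "length u = length v" "u \<noteq> v" "set u \<subseteq> {1..}" "set v \<subseteq> {1..}"
  shows "interior (Jw u) \<inter> interior (Jw v) = {}"
  using assms
proof (induction u arbitrary: v rule: rev_induct)
  case (snoc i u)
  obtain v' j where v: "v = v' @ [j]" using snoc.prems(1) by (cases v rule: rev_cases) auto
  show ?case
  proof (cases "u = v'")
    case True
    then show ?thesis using osc[of u i j] snoc.prems v by auto
  next
    case False
    then have "interior (Jw u) \<inter> interior (Jw v') = {}"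
      using snoc v by auto
    moreover have "Jw (u @ [i]) \<subseteq> Jw u" "Jw v \<subseteq> Jw v'"
      unfolding v by (rule Jw_snoc; use snoc.prems v in simp)+
    ultimately show ?thesis using interior_mono by blast
  qed
qed simp

text \<open>
  The inner balls of \<open>J\<close> are carried to \<open>Jw u\<close> by \<open>\<phi>\<^sub>u\<close>, which on small balls distorts distances by at most the
  factors \<open>q 1 u / C\<close> and \<open>C * q 1 u\<close>. The balls of radius at most \<open>\<eta>\<close> around points of \<open>J\<close> lie in \<open>V\<close>, so the
  mean value inequality applies on them.
\<close>

lemma inner_ball_Jw:
  obtains a b where "a > 0" "b > 0"
    and "\<And>u y s. set u \<subseteq> {1..} \<Longrightarrow> y \<in> Jw u \<Longrightarrow> 0 < s \<Longrightarrow> s \<le> 1 \<Longrightarrow>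
      \<exists>w. ball w (a * s * q 1 u) \<subseteq> interior (Jw u) \<inter> ball y (b * s * q 1 u)"
proof -
  obtain \<kappa> \<rho>0 where \<kappa>: "\<kappa> > 0" "\<rho>0 > 0" and
    in_J: "\<And>z \<rho>. z \<in> J \<Longrightarrow> 0 < \<rho> \<Longrightarrow> \<rho> \<le> \<rho>0 \<Longrightarrow> \<exists>w. ball w (\<kappa> * \<rho>) \<subseteq> interior J \<inter> ball z \<rho>"
    using cone_condition_inner_ball[OF compact_imp_closed[OF compact_J] cone] by blast
  obtain \<eta> where \<eta>: "\<eta> > 0" "(\<Union>z\<in>J. ball z \<eta>) \<subseteq> V"
    using compact_subset_open_imp_ball_epsilon_subset[OF compact_J V(1,3)] by blast
  define \<rho>1 where "\<rho>1 = min \<rho>0 \<eta>"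
  have \<rho>1: "\<rho>1 > 0" "\<rho>1 \<le> \<rho>0" "\<rho>1 \<le> \<eta>" using \<kappa> \<eta> by (auto simp: \<rho>1_def)
  show thesis
  proof (rule that[of "\<kappa> * \<rho>1 / C" "C * \<rho>1"])
    fix u y and s :: real assume u: "set u \<subseteq> {1..}" and y: "y \<in> Jw u" and s: "0 < s" "s \<le> 1"
    let ?f = "word_map \<phi> 1 u"
    obtain \<omega> where \<omega>: "Jw u = (\<lambda>x. ?f x + \<omega>) ` J" using Jw_image u by blast
    obtain z where z: "z \<in> J" "y = ?f z + \<omega>" using y \<omega> by auto
    have f: "conformal_on V ?f" "inj_on ?f V" using word_map_V[of 1 u] u by auto
    have q: "q 1 u > 0" using deriv_norm_q(4) u by simp
    define \<rho> where "\<rho> = \<rho>1 * s"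
    have "\<rho> \<le> \<rho>1 * 1" unfolding \<rho>_def using \<rho>1 s by (intro mult_left_mono) auto
    moreover have "0 < \<rho>" using \<rho>1 s by (simp add: \<rho>_def)
    ultimately have \<rho>: "0 < \<rho>" "\<rho> \<le> \<rho>0" "\<rho> \<le> \<eta>" using \<rho>1 by auto
    obtain w where w: "ball w (\<kappa> * \<rho>) \<subseteq> interior J \<inter> ball z \<rho>" using in_J[OF z(1) \<rho>(1,2)] by blast
    have zV: "ball z \<rho> \<subseteq> V"
      using \<eta>(2) z(1) subset_ball[OF \<rho>(3), of z] by blast
    have "ball (?f w) (q 1 u / C * (\<kappa> * \<rho>)) \<subseteq> ?f ` ball w (\<kappa> * \<rho>)"
    proof (rule conformal_image_contains_ball[OF V(1) f(2,1)])
      show "q 1 u / C \<le> deriv_norm ?f x" if "x \<in> V" for x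
        using deriv_norm_q(2)[of 1 u x] u that C by (simp add: field_simps)
    qed (use w zV \<kappa> \<rho> q C in auto)
    moreover have "?f ` ball w (\<kappa> * \<rho>) \<subseteq> ?f ` J \<inter> ball (?f z) (C * q 1 u * \<rho>)"
    proof -
      have "dist (?f z) (?f x) < C * q 1 u * \<rho>" if "x \<in> ball z \<rho>" for x
      proof -
        have "dist (?f z) (?f x) \<le> (C * q 1 u) * dist z x"
          using deriv_norm_q(3)[of 1 u] u
          by (intro conformal_on_lipschitz_ball[OF f(1) zV that]) auto
        also have "\<dots> < C * q 1 u * \<rho>" using that q C by simp
        finally show ?thesis .
      qed
      moreover have "ball w (\<kappa> * \<rho>) \<subseteq> J" using w interior_subset by blast
      ultimately show ?thesis using w by auto
    qed
    ultimately have sub: "ball (?f w) (q 1 u / C * (\<kappa> * \<rho>)) \<subseteq> ?f ` J \<inter> ball (?f z) (C * q 1 u * \<rho>)"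
      by blast
    have "ball (?f w + \<omega>) (\<kappa> * \<rho>1 / C * s * q 1 u) \<subseteq> Jw u \<inter> ball y (C * \<rho>1 * s * q 1 u)"
    proof
      fix p assume "p \<in> ball (?f w + \<omega>) (\<kappa> * \<rho>1 / C * s * q 1 u)"
      then have "p - \<omega> \<in> ball (?f w) (q 1 u / C * (\<kappa> * \<rho>))"
        by (simp add: dist_norm \<rho>_def algebra_simps)
      then have "p - \<omega> \<in> ?f ` J" "p - \<omega> \<in> ball (?f z) (C * q 1 u * \<rho>)" using sub by auto
      moreover have "p \<in> Jw u" if "p - \<omega> \<in> ?f ` J"
        using that unfolding \<omega> by (auto simp: diff_eq_eq)
      ultimately show "p \<in> Jw u \<inter> ball y (C * \<rho>1 * s * q 1 u)"
        by (simp add: z(2) dist_norm \<rho>_def algebra_simps)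
    qed
    then show "\<exists>w. ball w (\<kappa> * \<rho>1 / C * s * q 1 u) \<subseteq> interior (Jw u) \<inter> ball y (C * \<rho>1 * s * q 1 u)"
      by (intro exI[of _ "?f w + \<omega>"]) (simp add: interior_maximal)
  qed (use \<kappa> \<rho>1 C in auto)
qed

text \<open>
  Each such piece contains a ball of radius comparable to \<open>r\<close> within a comparable distance of \<open>x\<close>, and these balls
  are disjoint. The words have equal length because otherwise one piece may contain another.
\<close>

lemma card_large_pieces_near_ball:
  obtains K where "K \<ge> 0"
    and "\<And>H n x r. finite H \<Longrightarrow> 0 < r \<Longrightarrow>
      (\<And>u. u \<in> H \<Longrightarrow> set u \<subseteq> {1..} \<and> length u = n \<and> r < q 1 u \<and> Jw u \<inter> ball x r \<noteq> {}) \<Longrightarrow>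
      real (card H) \<le> K"
proof -
  obtain a b where ab: "a > 0" "b > 0" and
    inner: "\<And>u y s. set u \<subseteq> {1..} \<Longrightarrow> y \<in> Jw u \<Longrightarrow> 0 < s \<Longrightarrow> s \<le> 1 \<Longrightarrow>
      \<exists>w. ball w (a * s * q 1 u) \<subseteq> interior (Jw u) \<inter> ball y (b * s * q 1 u)"
    using inner_ball_Jw by blast
  show thesis
  proof (rule that[of "((1 + b) / a) ^ DIM('a)"])
    fix H n x and r :: real assume H: "finite H" and r: "0 < r"
      and u: "\<And>u. u \<in> H \<Longrightarrow> set u \<subseteq> {1..} \<and> length u = n \<and> r < q 1 u \<and> Jw u \<inter> ball x r \<noteq> {}"
    have ex: "\<exists>w. ball w (a * r) \<subseteq> interior (Jw u) \<inter> ball x ((1 + b) * r)" if uH: "u \<in> H" for u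
    proof -
      obtain y where y: "y \<in> Jw u" "dist x y < r" using u[OF uH] by auto
      have q: "r < q 1 u" "q 1 u > 0" using u[OF uH] r by auto
      obtain w where w: "ball w (a * (r / q 1 u) * q 1 u)
          \<subseteq> interior (Jw u) \<inter> ball y (b * (r / q 1 u) * q 1 u)"
        using inner[of u y "r / q 1 u"] u[OF uH] y(1) q r by auto
      have "ball y (b * r) \<subseteq> ball x ((1 + b) * r)"
      proof
        fix p assume "p \<in> ball y (b * r)"
        then show "p \<in> ball x ((1 + b) * r)"
          using dist_triangle[of x p y] y(2) by (simp add: distrib_right)
      qed
      then show ?thesis using w q by (intro exI[of _ w]) auto
    qed
    obtain w where w: "\<And>u. u \<in> H \<Longrightarrow> ball (w u) (a * r) \<subseteq> interior (Jw u) \<inter> ball x ((1 + b) * r)"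
      using ex by metis
    have "(\<Sum>u\<in>H. (a * r) ^ DIM('a)) \<le> ((1 + b) * r) ^ DIM('a)"
    proof (rule sum_radius_power_packing[OF H])
      show "disjoint_family_on (\<lambda>u. ball (w u) (a * r)) H"
        unfolding disjoint_family_on_def
      proof (intro ballI impI)
        fix u v assume uv: "u \<in> H" "v \<in> H" "u \<noteq> v"
        then have "interior (Jw u) \<inter> interior (Jw v) = {}"
          using u by (intro interior_Jw_disjoint) auto
        then show "ball (w u) (a * r) \<inter> ball (w v) (a * r) = {}"
          using w[OF uv(1)] w[OF uv(2)] by blast
      qed
      show "ball (w u) (a * r) \<subseteq> ball x ((1 + b) * r)" if "u \<in> H" for u
        using w[OF that] by blast
    qed (use ab r in auto)
    then have "real (card H) * (a ^ DIM('a)) * r ^ DIM('a) \<le> (1 + b) ^ DIM('a) * r ^ DIM('a)"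
      by (simp add: power_mult_distrib mult.assoc)
    then have "real (card H) * (a ^ DIM('a)) \<le> (1 + b) ^ DIM('a)"
      using r by simp
    then show "real (card H) \<le> ((1 + b) / a) ^ DIM('a)"
      using ab by (simp add: power_divide pos_le_divide_eq)
  qed (use ab in auto)
qed

text \<open>
  The pieces of one level contain disjoint balls of radius proportional to \<open>q 1 u\<close>, all inside the bounded set \<open>J\<close>.
\<close>

lemma sum_q_power_dim:
  obtains K where "K > 0"
    and "\<And>H n. finite H \<Longrightarrow> (\<And>u. u \<in> H \<Longrightarrow> set u \<subseteq> {1..} \<and> length u = n) \<Longrightarrow>
      (\<Sum>u\<in>H. q 1 u ^ DIM('a)) \<le> K"
proof -
  obtain a b where ab: "a > 0" "b > 0" and
    inner: "\<And>u y s. set u \<subseteq> {1..} \<Longrightarrow> y \<in> Jw u \<Longrightarrow> 0 < s \<Longrightarrow> s \<le> 1 \<Longrightarrow>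
      \<exists>w. ball w (a * s * q 1 u) \<subseteq> interior (Jw u) \<inter> ball y (b * s * q 1 u)"
    using inner_ball_Jw by blast
  obtain R where R: "R > 0" "J \<subseteq> ball 0 R"
    using bounded_subset_ballD[OF compact_imp_bounded[OF compact_J]] by blast
  show thesis
  proof (rule that[of "(R / a) ^ DIM('a)"])
    fix H :: "nat list set" and n assume H: "finite H"
      and u: "\<And>u. u \<in> H \<Longrightarrow> set u \<subseteq> {1..} \<and> length u = n"
    have ex: "\<exists>w. ball w (a * q 1 u) \<subseteq> interior (Jw u)" if uH: "u \<in> H" for u
    proof -
      obtain y where "y \<in> Jw u" using Jw_nonempty_compact(1) u[OF uH] by blast
      then show ?thesis using inner[of u y 1] u[OF uH] by auto
    qed
    obtain w where w: "\<And>u. u \<in> H \<Longrightarrow> ball (w u) (a * q 1 u) \<subseteq> interior (Jw u)"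
      using ex by metis
    have "(\<Sum>u\<in>H. (a * q 1 u) ^ DIM('a)) \<le> R ^ DIM('a)"
    proof (rule sum_radius_power_packing[OF H])
      show "disjoint_family_on (\<lambda>u. ball (w u) (a * q 1 u)) H"
        unfolding disjoint_family_on_def
      proof (intro ballI impI)
        fix u v assume uv: "u \<in> H" "v \<in> H" "u \<noteq> v"
        then have "interior (Jw u) \<inter> interior (Jw v) = {}"
          using u by (intro interior_Jw_disjoint) auto
        then show "ball (w u) (a * q 1 u) \<inter> ball (w v) (a * q 1 v) = {}"
          using w[OF uv(1)] w[OF uv(2)] by blast
      qed
      show "ball (w u) (a * q 1 u) \<subseteq> ball 0 R" if "u \<in> H" for u
        using w[OF that] interior_subset Jw_append[of "[]" u] u[OF that] Jw_Nil R(2) by fastforce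
      show "0 \<le> a * q 1 u" if "u \<in> H" for u
        using ab deriv_norm_q(4)[of 1 u] u[OF that] by auto
    qed (use R in auto)
    then have "a ^ DIM('a) * (\<Sum>u\<in>H. q 1 u ^ DIM('a)) \<le> R ^ DIM('a)"
      by (simp add: power_mult_distrib sum_distrib_left)
    then show "(\<Sum>u\<in>H. q 1 u ^ DIM('a)) \<le> (R / a) ^ DIM('a)"
      using ab by (simp add: power_divide pos_le_divide_eq mult.commute)
  qed (use ab R in auto)
qed

end

section \<open>Words over restricted alphabets\<close>

text \<open>
  Words of length \<open>n\<close> whose first letter belongs to level \<open>l\<close>. The recursion on \<open>n\<close> turns sums over words into
  iterated sums over letters.
\<close>

primrec alphabet_words :: "(nat \<Rightarrow> 'b set) \<Rightarrow> nat \<Rightarrow> nat \<Rightarrow> 'b list set" where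
  "alphabet_words A l 0 = {[]}"
| "alphabet_words A l (Suc n) = (\<lambda>(i, u). i # u) ` (A l \<times> alphabet_words A (Suc l) n)"

lemma alphabet_words_length: "u \<in> alphabet_words A l n \<Longrightarrow> length u = n"
  by (induction n arbitrary: l u) auto

lemma alphabet_words_set: "(\<And>j. A j \<subseteq> S) \<Longrightarrow> u \<in> alphabet_words A l n \<Longrightarrow> set u \<subseteq> S"
  by (induction n arbitrary: l u) (auto, blast+)

lemma finite_alphabet_words: "(\<And>j. finite (A j)) \<Longrightarrow> finite (alphabet_words A l n)"
  by (induction n arbitrary: l) auto

lemma alphabet_words_nonempty: "(\<And>j. A j \<noteq> {}) \<Longrightarrow> alphabet_words A l n \<noteq> {}"
  by (induction n arbitrary: l) auto

lemma alphabet_words_const: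
  "alphabet_words (\<lambda>_. S) l n = {u. length u = n \<and> set u \<subseteq> S}"
proof (induction n arbitrary: l)
  case (Suc n)
  have "u \<in> (\<lambda>(i, u). i # u) ` (S \<times> {u. length u = n \<and> set u \<subseteq> S}) \<longleftrightarrow>
      length u = Suc n \<and> set u \<subseteq> S" for u
    by (cases u) auto
  then show ?case using Suc by auto
qed auto

lemma sum_alphabet_words_Suc:
  "(\<Sum>u\<in>alphabet_words A l (Suc n). f u) =
   (\<Sum>i\<in>A l. \<Sum>u\<in>alphabet_words A (Suc l) n. f (i # u))"
proof -
  have "inj_on (\<lambda>(i, u). i # u) (A l \<times> alphabet_words A (Suc l) n)"
    by (auto simp: inj_on_def)
  then show ?thesis
    by (simp add: sum.reindex sum.cartesian_product split_def)
qed

lemma sum_alphabet_words_add: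
  "(\<Sum>u\<in>alphabet_words A l (m + n). f u) =
   (\<Sum>u\<in>alphabet_words A l m. \<Sum>v\<in>alphabet_words A (l + m) n. f (u @ v))"
proof (induction m arbitrary: l f)
  case (Suc m)
  show ?case
    unfolding add_Suc sum_alphabet_words_Suc by (simp add: Suc.IH)
qed simp

lemma append_in_alphabet_words:
  "length u = m \<Longrightarrow>
   u @ v \<in> alphabet_words A l (m + n) \<longleftrightarrow> u \<in> alphabet_words A l m \<and> v \<in> alphabet_words A (l + m) n"
  by (induction m arbitrary: l u) (auto simp: length_Suc_conv image_iff)

lemma sum_triple_Sigma:
  assumes "finite I" "\<And>j. finite (G j)" "\<And>j p. finite (B j p)"
  shows "(\<Sum>(j, p, i)\<in>(SIGMA j:I. SIGMA p:G j. B j p). f j p i) =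
    (\<Sum>j\<in>I. \<Sum>p\<in>G j. \<Sum>i\<in>B j p. f j p i)"
  using assms by (simp add: sum.Sigma)

section \<open>Partition sums\<close>

context conformal_ifs
begin

text \<open>
  The partition function of the system restricted to the alphabets \<open>A\<close>.
\<close>

definition Z :: "(nat \<Rightarrow> nat set) \<Rightarrow> real \<Rightarrow> nat \<Rightarrow> nat \<Rightarrow> real" where
  "Z A t l n = (\<Sum>u\<in>alphabet_words A l n. q l u powr t)"

lemma Z_nonneg: "Z A t l n \<ge> 0"
  by (simp add: Z_def sum_nonneg)

lemma Z_pos:
  assumes A: "\<And>j. finite (A j)" "\<And>j. A j \<noteq> {}" "\<And>j. A j \<subseteq> {1..}" and l: "l \<ge> 1"
  shows "Z A t l n > 0"
  unfolding Z_def
proof (rule sum_pos)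
  fix u assume "u \<in> alphabet_words A l n"
  then have "q l u > 0"
    using deriv_norm_q(4)[OF l] alphabet_words_set[of A, OF A(3)] by blast
  then show "q l u powr t > 0" by simp
qed (use A in \<open>auto simp: finite_alphabet_words alphabet_words_nonempty\<close>)

lemma Z_supermultiplicative:
  assumes A: "\<And>j. A j \<subseteq> {1..}" and l: "l \<ge> 1" and t: "t \<ge> 0"
  shows "Z A t l m * Z A t (l + m) n \<le> C powr t * Z A t l (m + n)"
proof -
  have "Z A t l m * Z A t (l + m) n =
      (\<Sum>u\<in>alphabet_words A l m. \<Sum>v\<in>alphabet_words A (l + m) n. q l u powr t * q (l + m) v powr t)"
    by (simp add: Z_def sum_product)
  also have "\<dots> \<le> (\<Sum>u\<in>alphabet_words A l m. \<Sum>v\<in>alphabet_words A (l + m) n.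
      C powr t * q l (u @ v) powr t)"
  proof (intro sum_mono)
    fix u v assume uv: "u \<in> alphabet_words A l m" "v \<in> alphabet_words A (l + m) n"
    then have s: "set u \<subseteq> {1..}" "set v \<subseteq> {1..}" "length u = m"
      using alphabet_words_set[of A, OF A] alphabet_words_length by blast+
    have "(q l u * q (l + m) v) powr t \<le> (C * q l (u @ v)) powr t"
      using q_append(2)[OF l s(1,2)] s l t deriv_norm_q(4)[OF l s(1)] deriv_norm_q(4)[of "l + m" v]
      by (intro powr_mono2) auto
    then show "q l u powr t * q (l + m) v powr t \<le> C powr t * q l (u @ v) powr t"
      using deriv_norm_q(4)[OF l s(1)] deriv_norm_q(4)[of "l + m" v] deriv_norm_q(4)[of l "u @ v"] s l C
      by (simp add: powr_mult)
  qed
  also have "\<dots> = C powr t * Z A t l (m + n)"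
    by (simp add: Z_def sum_alphabet_words_add sum_distrib_left)
  finally show ?thesis .
qed

text \<open>
  Enlarging the alphabet at one level only. Up to the factor \<open>C powr (2 * t)\<close> the terms are products of a
  quantity independent of \<open>i\<close> with the one-letter term \<open>q l [i] powr t\<close>, so the proportion lost by
  discarding letters is governed by the one-letter sums alone.
\<close>

lemma one_letter_truncation:
  assumes p: "set p \<subseteq> {1..}" "l = Suc (length p)" and v: "set v \<subseteq> {1..}" and t: "t \<ge> 0"
    and AB: "finite B" "A \<subseteq> B" "B \<subseteq> {1..}" and e: "e \<ge> 0"
    and tail: "C powr (2 * t) * (\<Sum>i\<in>B - A. q l [i] powr t) \<le> e * (\<Sum>i\<in>A. q l [i] powr t)"
  shows "(\<Sum>i\<in>B. q 1 (p @ i # v) powr t) \<le> (1 + e) * (\<Sum>i\<in>A. q 1 (p @ i # v) powr t)"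
proof -
  define X where "X = (q 1 p * q (Suc l) v) powr t"
  have l: "l \<ge> 1" using p by simp
  have pos: "q 1 p > 0" "q (Suc l) v > 0" using deriv_norm_q(4) p v by auto
  have Ct2: "C powr (2 * t) = C powr t * C powr t" by (simp add: powr_add[symmetric])
  have cmp: "q 1 (p @ i # v) powr t \<le> X * q l [i] powr t \<and>
      X * q l [i] powr t \<le> C powr (2 * t) * q 1 (p @ i # v) powr t" if "i \<in> B" for i
  proof -
    have i: "i \<ge> 1" using that AB by auto
    have iv: "set (i # v) \<subseteq> {1..}" "set [i] \<subseteq> {1..}" using i v by auto
    have posi: "q l [i] > 0" "q l (i # v) > 0" "q 1 (p @ i # v) > 0"
      using deriv_norm_q(4) iv p l by auto
    have a: "q 1 (p @ i # v) \<le> q 1 p * q l (i # v)" "q 1 p * q l (i # v) \<le> C * q 1 (p @ i # v)"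
      using q_append[of 1 p "i # v"] p iv by auto
    have b: "q l (i # v) \<le> q l [i] * q (Suc l) v" "q l [i] * q (Suc l) v \<le> C * q l (i # v)"
      using q_append[of l "[i]" v] iv v l by auto
    have "q 1 (p @ i # v) \<le> q 1 p * (q l [i] * q (Suc l) v)"
      using a(1) mult_left_mono[OF b(1), of "q 1 p"] pos by linarith
    then have "q 1 (p @ i # v) powr t \<le> (q 1 p * (q l [i] * q (Suc l) v)) powr t"
      using posi t by (intro powr_mono2) auto
    also have "\<dots> = X * q l [i] powr t"
      using pos posi by (simp add: X_def powr_mult)
    finally have 1: "q 1 (p @ i # v) powr t \<le> X * q l [i] powr t" .
    have "q 1 p * (q l [i] * q (Suc l) v) \<le> C * (q 1 p * q l (i # v))"
      using mult_left_mono[OF b(2), of "q 1 p"] pos by (simp add: mult_ac)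
    also have "\<dots> \<le> C * (C * q 1 (p @ i # v))"
      using a(2) C by (intro mult_left_mono) auto
    finally have "(q 1 p * (q l [i] * q (Suc l) v)) powr t \<le> (C * (C * q 1 (p @ i # v))) powr t"
      using pos posi t by (intro powr_mono2) auto
    then have "X * q l [i] powr t \<le> C powr (2 * t) * q 1 (p @ i # v) powr t"
      using pos posi C Ct2 by (simp add: X_def powr_mult mult_ac)
    with 1 show ?thesis by simp
  qed
  have X: "X \<ge> 0" by (simp add: X_def)
  have Ct: "C powr (2 * t) > 0" using C by simp
  let ?g = "\<lambda>i. q 1 (p @ i # v) powr t"
  have "C powr (2 * t) * (\<Sum>i\<in>B - A. ?g i) \<le> C powr (2 * t) * (\<Sum>i\<in>B - A. X * q l [i] powr t)"
    using cmp Ct by (intro mult_left_mono sum_mono) auto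
  also have "\<dots> = X * (C powr (2 * t) * (\<Sum>i\<in>B - A. q l [i] powr t))"
    by (simp add: sum_distrib_left mult_ac)
  also have "\<dots> \<le> X * (e * (\<Sum>i\<in>A. q l [i] powr t))"
    using tail X by (rule mult_left_mono)
  also have "\<dots> = e * (\<Sum>i\<in>A. X * q l [i] powr t)"
    by (simp add: sum_distrib_left mult_ac)
  also have "\<dots> \<le> e * (\<Sum>i\<in>A. C powr (2 * t) * ?g i)"
    using cmp AB e by (intro mult_left_mono sum_mono) auto
  also have "\<dots> = C powr (2 * t) * (e * (\<Sum>i\<in>A. ?g i))"
    by (simp add: sum_distrib_left mult_ac)
  finally have "(\<Sum>i\<in>B - A. ?g i) \<le> e * (\<Sum>i\<in>A. ?g i)"
    using Ct by (simp only: mult_le_cancel_left_pos)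
  then show ?thesis
    using sum.subset_diff[OF AB(2,1), of ?g] by (simp add: distrib_right)
qed

text \<open>
  The alphabets are changed one level at a time, starting from the last letter. The prefix \<open>p\<close>
  is arbitrary in the induction.
\<close>

lemma Z_truncation:
  assumes t: "t \<ge> 0"
    and AB: "\<And>j. finite (B j)" "\<And>j. A j \<subseteq> B j" "\<And>j. B j \<subseteq> {1..}" and e: "\<And>j. e j \<ge> 0"
    and tail: "\<And>j. j \<ge> 1 \<Longrightarrow>
      C powr (2 * t) * (\<Sum>i\<in>B j - A j. q j [i] powr t) \<le> e j * (\<Sum>i\<in>A j. q j [i] powr t)"
  shows "Z B t 1 n \<le> (\<Prod>j\<in>{1..n}. 1 + e j) * Z A t 1 n"
proof -
  have gen: "(\<Sum>v\<in>alphabet_words B (Suc (length p)) n. q 1 (p @ v) powr t)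
      \<le> (\<Prod>j\<in>{Suc (length p)..length p + n}. 1 + e j) *
        (\<Sum>v\<in>alphabet_words A (Suc (length p)) n. q 1 (p @ v) powr t)"
    if "set p \<subseteq> {1..}" for p
    using that
  proof (induction n arbitrary: p)
    case (Suc n)
    let ?l = "Suc (length p)"
    let ?P = "\<Prod>j\<in>{Suc ?l..?l + n}. 1 + e j"
    have P0: "?P \<ge> 0" using e by (intro prod_nonneg) (auto simp: add_nonneg_nonneg)
    have "(\<Sum>v\<in>alphabet_words B ?l (Suc n). q 1 (p @ v) powr t) =
        (\<Sum>i\<in>B ?l. \<Sum>v\<in>alphabet_words B (Suc ?l) n. q 1 (p @ i # v) powr t)"
      by (rule sum_alphabet_words_Suc)
    also have "\<dots> \<le> (\<Sum>i\<in>B ?l. ?P * (\<Sum>v\<in>alphabet_words A (Suc ?l) n. q 1 (p @ i # v) powr t))"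
    proof (rule sum_mono)
      fix i assume "i \<in> B ?l"
      then have "set (p @ [i]) \<subseteq> {1..}" using AB(3) Suc.prems by auto
      from Suc.IH[OF this]
      show "(\<Sum>v\<in>alphabet_words B (Suc ?l) n. q 1 (p @ i # v) powr t)
          \<le> ?P * (\<Sum>v\<in>alphabet_words A (Suc ?l) n. q 1 (p @ i # v) powr t)"
        by simp
    qed
    also have "\<dots> = ?P * (\<Sum>v\<in>alphabet_words A (Suc ?l) n. \<Sum>i\<in>B ?l. q 1 (p @ i # v) powr t)"
      by (subst sum.swap) (simp add: sum_distrib_left)
    also have "\<dots> \<le> ?P * (\<Sum>v\<in>alphabet_words A (Suc ?l) n.
        (1 + e ?l) * (\<Sum>i\<in>A ?l. q 1 (p @ i # v) powr t))"
    proof (intro mult_left_mono[OF _ P0] sum_mono)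
      fix v assume v: "v \<in> alphabet_words A (Suc ?l) n"
      have "set v \<subseteq> {1..}"
        using v AB(2,3) by (intro alphabet_words_set[of A _ v]) blast+
      then show "(\<Sum>i\<in>B ?l. q 1 (p @ i # v) powr t) \<le> (1 + e ?l) * (\<Sum>i\<in>A ?l. q 1 (p @ i # v) powr t)"
        using AB e t tail[of ?l] Suc.prems by (intro one_letter_truncation) auto
    qed
    also have "\<dots> = ((1 + e ?l) * ?P) *
        (\<Sum>i\<in>A ?l. \<Sum>v\<in>alphabet_words A (Suc ?l) n. q 1 (p @ i # v) powr t)"
      by (subst sum.swap) (simp only: sum_distrib_left[symmetric] mult_ac)
    also have "(1 + e ?l) * ?P = (\<Prod>j\<in>{?l..length p + Suc n}. 1 + e j)"
      by (simp add: prod.atLeast_Suc_atMost)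
    also have "(\<Sum>i\<in>A ?l. \<Sum>v\<in>alphabet_words A (Suc ?l) n. q 1 (p @ i # v) powr t) =
        (\<Sum>v\<in>alphabet_words A ?l (Suc n). q 1 (p @ v) powr t)"
      by (rule sum_alphabet_words_Suc[symmetric])
    finally show ?case .
  qed simp
  show ?thesis using gen[of "[]"] by (simp add: Z_def)
qed

section \<open>The mass distribution\<close>

text \<open>
  The central estimate. Restrict the system to finite alphabets \<open>A\<close> and give a word \<open>u\<close> of length \<open>n\<close> the mass
  \<open>q 1 u powr t / Z A t 1 n\<close>. To bound the mass of the words whose piece meets a ball of radius \<open>r\<close>, cut each word
  after its first prefix with \<open>q \<le> r\<close>. The prefixes of length \<open>j\<close> just before the cut satisfy \<open>q > r\<close> and meet the ball,
  so there are at most \<open>K\<close> of them; each has at most \<open>card (A (Suc j)) \<le> exp (\<beta> * Suc j)\<close> continuations by one letter;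
  and all descendants of one such continuation together have mass at most a constant times \<open>r powr t / Z A t 1 (Suc j)\<close>.
  Since \<open>Z A t 1 (Suc j)\<close> grows at least like \<open>exp (\<gamma> * Suc j)\<close> with \<open>\<gamma> > \<beta>\<close>, the sum over \<open>j\<close> converges, and
  the mass is at most \<open>Q * r powr t\<close>.
\<close>

lemma hausdorff_measure_attractor_pos:
  fixes A :: "nat \<Rightarrow> nat set"
  assumes t: "t > 0"
    and A: "\<And>j. finite (A j)" "\<And>j. A j \<noteq> {}" "\<And>j. A j \<subseteq> {1..}"
    and a: "a > 0" "\<And>n. a * exp (\<gamma> * real n) \<le> Z A t 1 n"
    and \<beta>: "\<beta> < \<gamma>" "\<And>n. n \<ge> 1 \<Longrightarrow> real (card (A n)) \<le> exp (\<beta> * real n)"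
  shows "hausdorff_measure t (attractor Jw) \<noteq> 0"
proof -
  let ?W = "alphabet_words A 1"
  note W_set = alphabet_words_set[of A "{1..}", OF A(3)]
  have W_fin: "finite (alphabet_words A l n)" for l n
    using A(1) by (rule finite_alphabet_words)
  have Zpos: "Z A t l n > 0" if "l \<ge> 1" for l n using Z_pos A that by blast
  obtain K where K: "K \<ge> 0" "\<And>H n x r. finite H \<Longrightarrow> 0 < r \<Longrightarrow>
      (\<And>u. u \<in> H \<Longrightarrow> set u \<subseteq> {1..} \<and> length u = n \<and> r < q 1 u \<and> Jw u \<inter> ball x r \<noteq> {}) \<Longrightarrow>
      real (card H) \<le> K"
    using card_large_pieces_near_ball by blast
  define z where "z = exp (\<beta> - \<gamma>)"
  have z: "0 < z" "z < 1" using \<beta>(1) by (auto simp: z_def)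
  define Q where "Q = K * C powr t / a * (1 / (1 - z))"
  have hit: "(\<Sum>u\<in>{u \<in> ?W n. Jw u \<inter> ball x r \<noteq> {}}. q 1 u powr t) \<le> Q * r powr t * Z A t 1 n"
    if r: "0 < r" "r < 1" and n: "C * c ^ n \<le> r" for n x r
  proof -
    \<comment> \<open>\<open>G j\<close>: the prefixes just before the cut; \<open>B j p\<close>: the letters at which the cut occurs;
       \<open>S j p i\<close>: the words of length \<open>n\<close> cut after \<open>p @ [i]\<close>\<close>
    define G where "G j = {p \<in> ?W j. r < q 1 p \<and> Jw p \<inter> ball x r \<noteq> {}}" for j
    define B where "B j p = {i \<in> A (Suc j). q 1 (p @ [i]) \<le> r}" for j p
    define S where "S j p i = (\<lambda>v. (p @ [i]) @ v) ` alphabet_words A (Suc (Suc j)) (n - Suc j)" for j p i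
    define I where "I = (SIGMA j:{..<n}. SIGMA p:G j. B j p)"
    have fin: "finite I" "finite (G j)" "finite (B j p)" "finite (S j p i)" for j p i
      using W_fin A(1) by (auto simp: I_def G_def B_def S_def intro!: finite_SigmaI)
    have cover: "{u \<in> ?W n. Jw u \<inter> ball x r \<noteq> {}} \<subseteq> (\<Union>(j, p, i)\<in>I. S j p i)"
    proof
      fix u assume "u \<in> {u \<in> ?W n. Jw u \<inter> ball x r \<noteq> {}}"
      then have u: "u \<in> ?W n" "Jw u \<inter> ball x r \<noteq> {}" by auto
      have len: "length u = n" using u(1) by (rule alphabet_words_length)
      have uset: "set u \<subseteq> {1..}" using W_set u(1) by blast
      define k where "k = (LEAST k. q 1 (take k u) \<le> r)"
      have ex: "q 1 (take n u) \<le> r"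
        using q_le_power[of 1 u] uset len n by simp
      have k: "q 1 (take k u) \<le> r" "k \<le> n" "\<And>k'. k' < k \<Longrightarrow> r < q 1 (take k' u)"
        using LeastI[of "\<lambda>k. q 1 (take k u) \<le> r", OF ex]
          Least_le[of "\<lambda>k. q 1 (take k u) \<le> r", OF ex] not_less_Least[of _ "\<lambda>k. q 1 (take k u) \<le> r"]
        by (auto simp: k_def not_le)
      \<comment> \<open>here \<open>r < 1\<close> is used: the empty word is too large to be the cut\<close>
      have "k \<noteq> 0" using k(1) r q_Nil by (intro notI) auto
      then obtain j where j: "k = Suc j" by (cases k) auto
      let ?p = "take j u" and ?i = "u ! j" and ?v = "drop (Suc j) u"
      have jn: "j < n" using k(2) j by simp
      have split: "u = ?p @ [?i] @ ?v" using id_take_nth_drop[of j u] jn len by simp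
      have tk: "take k u = ?p @ [?i]" using jn len j by (simp add: take_Suc_conv_app_nth)
      have "?p @ ([?i] @ ?v) \<in> alphabet_words A 1 (j + (1 + (n - Suc j)))"
        using u(1) split jn by simp
      then have mem: "?p \<in> ?W j" "?i \<in> A (Suc j)" "?v \<in> alphabet_words A (Suc (Suc j)) (n - Suc j)"
        using append_in_alphabet_words[of ?p j "[?i] @ ?v" A 1 "1 + (n - Suc j)"] jn len
          append_in_alphabet_words[of "[?i]" 1 ?v A "Suc j" "n - Suc j"] by auto
      have "Jw u \<subseteq> Jw ?p"
        using Jw_append[of ?p "[?i] @ ?v"] uset split by metis
      then have "?p \<in> G j" using mem u(2) k(3)[of j] j by (auto simp: G_def)
      moreover have "?i \<in> B j ?p" using mem k(1) tk by (simp add: B_def)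
      moreover have "u \<in> S j ?p ?i"
        unfolding S_def using mem split by (intro image_eqI[of _ _ ?v]) auto
      ultimately show "u \<in> (\<Union>(j, p, i)\<in>I. S j p i)"
        using jn unfolding I_def by blast
    qed
    have piece: "(\<Sum>u\<in>S j p i. q 1 u powr t) \<le> r powr t * C powr t * Z A t 1 n / Z A t 1 (Suc j)"
      if "j < n" "p \<in> G j" "i \<in> B j p" for j p i
    proof -
      let ?l = "Suc (Suc j)"
      have p: "p \<in> ?W j" using that by (simp add: G_def)
      have pi: "set (p @ [i]) \<subseteq> {1..}" "length (p @ [i]) = Suc j"
        using W_set[OF p] alphabet_words_length[OF p] that(3) A(3) by (auto simp: B_def)
      have "(\<Sum>u\<in>S j p i. q 1 u powr t) =
          (\<Sum>v\<in>alphabet_words A ?l (n - Suc j). q 1 ((p @ [i]) @ v) powr t)"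
        unfolding S_def by (subst sum.reindex) (auto simp: inj_on_def)
      also have "\<dots> \<le> (\<Sum>v\<in>alphabet_words A ?l (n - Suc j). r powr t * q ?l v powr t)"
      proof (rule sum_mono)
        fix v assume "v \<in> alphabet_words A ?l (n - Suc j)"
        then have v: "set v \<subseteq> {1..}" using W_set by blast
        have qv: "q ?l v > 0" using deriv_norm_q(4)[of ?l v] v by simp
        have "q 1 ((p @ [i]) @ v) \<le> q 1 (p @ [i]) * q ?l v"
          using q_append(1)[of 1 "p @ [i]" v] pi v by simp
        also have "\<dots> \<le> r * q ?l v"
          using that(3) qv by (intro mult_right_mono) (auto simp: B_def)
        finally have "q 1 ((p @ [i]) @ v) powr t \<le> (r * q ?l v) powr t"
          using deriv_norm_q(4)[of 1 "(p @ [i]) @ v"] pi v t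
          by (intro powr_mono2) (auto simp: less_imp_le)
        then show "q 1 ((p @ [i]) @ v) powr t \<le> r powr t * q ?l v powr t"
          using r qv by (simp add: powr_mult)
      qed
      also have "\<dots> = r powr t * Z A t ?l (n - Suc j)"
        by (simp add: Z_def sum_distrib_left)
      also have "\<dots> \<le> r powr t * (C powr t * Z A t 1 n / Z A t 1 (Suc j))"
        using Z_supermultiplicative[of A 1 t "Suc j" "n - Suc j", OF A(3)] t that(1) Zpos[of 1 "Suc j"]
        by (intro mult_left_mono) (simp_all add: pos_le_divide_eq mult.commute)
      finally show ?thesis by (simp add: mult.assoc)
    qed
    have "(\<Sum>u\<in>{u \<in> ?W n. Jw u \<inter> ball x r \<noteq> {}}. q 1 u powr t)
        \<le> (\<Sum>u\<in>(\<Union>(j, p, i)\<in>I. S j p i). q 1 u powr t)"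
      using cover fin by (intro sum_mono2) auto
    also have "\<dots> \<le> (\<Sum>(j, p, i)\<in>I. \<Sum>u\<in>S j p i. q 1 u powr t)"
      using fin sum_UN_le[of I "\<lambda>(j, p, i). S j p i" "\<lambda>u. q 1 u powr t"]
      by (simp add: split_def)
    also have "\<dots> = (\<Sum>j<n. \<Sum>p\<in>G j. \<Sum>i\<in>B j p. \<Sum>u\<in>S j p i. q 1 u powr t)"
      unfolding I_def sum_triple_Sigma[OF finite_lessThan fin(2,3)] by simp
    also have "\<dots> \<le> (\<Sum>j<n. K * exp (\<beta> * real (Suc j)) *
        (r powr t * C powr t * Z A t 1 n / (a * exp (\<gamma> * real (Suc j)))))"
    proof (rule sum_mono)
      fix j assume "j \<in> {..<n}"
      then have j: "j < n" by simp
      let ?R = "r powr t * C powr t * Z A t 1 n / Z A t 1 (Suc j)"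
      have R0: "?R \<ge> 0" by (simp add: Z_nonneg)
      have "(\<Sum>p\<in>G j. \<Sum>i\<in>B j p. \<Sum>u\<in>S j p i. q 1 u powr t) \<le> (\<Sum>p\<in>G j. \<Sum>i\<in>B j p. ?R)"
        using piece j by (intro sum_mono) auto
      also have "\<dots> \<le> (\<Sum>p\<in>G j. real (card (A (Suc j))) * ?R)"
      proof (rule sum_mono)
        fix p
        have "card (B j p) \<le> card (A (Suc j))"
          using A(1) by (intro card_mono) (auto simp: B_def)
        then have "real (card (B j p)) * ?R \<le> real (card (A (Suc j))) * ?R"
          using R0 by (intro mult_right_mono) auto
        then show "(\<Sum>i\<in>B j p. ?R) \<le> real (card (A (Suc j))) * ?R" by simp
      qed
      also have "\<dots> = real (card (G j)) * real (card (A (Suc j))) * ?R" by simp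
      also have "\<dots> \<le> K * exp (\<beta> * real (Suc j)) * ?R"
      proof (intro mult_right_mono mult_mono R0)
        show "real (card (G j)) \<le> K"
        proof (rule K(2)[OF fin(2) r(1)])
          fix p assume "p \<in> G j"
          then show "set p \<subseteq> {1..} \<and> length p = j \<and> r < q 1 p \<and> Jw p \<inter> ball x r \<noteq> {}"
            using W_set[of p 1 j] alphabet_words_length[of p A 1 j] by (simp add: G_def)
        qed
        show "real (card (A (Suc j))) \<le> exp (\<beta> * real (Suc j))" by (rule \<beta>(2)) simp
      qed (use K in auto)
      also have "\<dots> \<le> K * exp (\<beta> * real (Suc j)) *
          (r powr t * C powr t * Z A t 1 n / (a * exp (\<gamma> * real (Suc j))))"
        using K(1) a(1) a(2)[of "Suc j"] Zpos
        by (intro mult_left_mono divide_left_mono mult_nonneg_nonneg mult_pos_pos)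
          (simp_all add: Z_nonneg)
      finally show "(\<Sum>p\<in>G j. \<Sum>i\<in>B j p. \<Sum>u\<in>S j p i. q 1 u powr t) \<le> \<dots>" .
    qed
    also have "\<dots> = (\<Sum>j<n. z ^ Suc j) * (K * C powr t / a * r powr t * Z A t 1 n)"
      unfolding sum_distrib_right
    proof (rule sum.cong[OF refl])
      fix j
      have "z ^ Suc j = exp (\<beta> * real (Suc j)) / exp (\<gamma> * real (Suc j))"
        unfolding z_def exp_of_nat_mult[symmetric] exp_diff[symmetric] by (simp add: algebra_simps)
      then show "K * exp (\<beta> * real (Suc j)) *
          (r powr t * C powr t * Z A t 1 n / (a * exp (\<gamma> * real (Suc j)))) =
          z ^ Suc j * (K * C powr t / a * r powr t * Z A t 1 n)"
        by (simp only: times_divide_eq_left times_divide_eq_right divide_divide_eq_left mult_ac)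
    qed
    also have "\<dots> \<le> 1 / (1 - z) * (K * C powr t / a * r powr t * Z A t 1 n)"
    proof (rule mult_right_mono)
      have "(\<Sum>j<n. z ^ Suc j) \<le> (\<Sum>j<n. z ^ j)"
        using z by (intro sum_mono power_decreasing) auto
      also have "\<dots> \<le> (\<Sum>j. z ^ j)"
        using z by (intro sum_le_suminf summable_geometric) auto
      also have "\<dots> = 1 / (1 - z)" using z by (intro suminf_geometric) auto
      finally show "(\<Sum>j<n. z ^ Suc j) \<le> 1 / (1 - z)" .
    qed (use K a in \<open>auto simp: Z_nonneg\<close>)
    also have "\<dots> = Q * r powr t * Z A t 1 n" by (simp add: Q_def)
    finally show ?thesis .
  qed
  show ?thesis
  proof (rule mass_distribution[where K = "\<lambda>n. \<Union>u\<in>?W n. Jw u" and W = ?W and P = Jw and Q = Q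
        and w = "\<lambda>n u. q 1 u powr t / Z A t 1 n"])
    show "compact (\<Union>u\<in>?W n. Jw u)" for n
      using W_fin Jw_nonempty_compact(2) W_set by (intro compact_UN) auto
    show "(\<Union>u\<in>?W n. Jw u) \<subseteq> (\<Union>u\<in>?W m. Jw u)" if "m \<le> n" for m n
    proof (rule UN_least)
      fix u assume u: "u \<in> ?W n"
      have "take m u @ drop m u \<in> alphabet_words A 1 (m + (n - m))" using u that by simp
      then have "take m u \<in> ?W m"
        using append_in_alphabet_words[of "take m u" m "drop m u" A 1 "n - m"] that
          alphabet_words_length[OF u] by simp
      moreover have "Jw u \<subseteq> Jw (take m u)"
        using Jw_append[of "take m u" "drop m u"] W_set[OF u] by simp
      ultimately show "Jw u \<subseteq> (\<Union>u\<in>?W m. Jw u)" by blast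
    qed
    show "(\<Inter>n. \<Union>u\<in>?W n. Jw u) \<subseteq> attractor Jw"
      unfolding attractor_def
    proof (rule INT_greatest)
      fix k :: nat
      have "?W k \<subseteq> words 1 k"
        using W_set alphabet_words_length by (auto simp: words_def)
      then have "(\<Union>u\<in>?W k. Jw u) \<subseteq> (\<Union>u\<in>words 1 k. Jw u)" by (rule UN_mono) simp
      then show "(\<Inter>n. \<Union>u\<in>?W n. Jw u) \<subseteq> (\<Union>u\<in>words 1 k. Jw u)"
        by (rule INF_lower2[OF UNIV_I])
    qed
    show "Jw u \<noteq> {} \<and> Jw u \<subseteq> (\<Union>u\<in>?W n. Jw u)" if "u \<in> ?W n" for n u
      using Jw_nonempty_compact(1)[OF W_set[OF that]] that by blast
    show "(\<Sum>u\<in>?W n. q 1 u powr t / Z A t 1 n) = 1" for n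
      using Zpos[of 1 n] unfolding sum_divide_distrib[symmetric] Z_def by simp
    show "\<exists>N. \<forall>n\<ge>N. \<forall>x. (\<Sum>u\<in>{u \<in> ?W n. Jw u \<inter> ball x r \<noteq> {}}. q 1 u powr t / Z A t 1 n)
        \<le> Q * r powr t" if r: "0 < r" "r < 1" for r
    proof -
      obtain N where N: "c ^ N < r / C"
        using real_arch_pow_inv[of "r / C" c] c C r by auto
      have "(\<Sum>u\<in>{u \<in> ?W n. Jw u \<inter> ball x r \<noteq> {}}. q 1 u powr t / Z A t 1 n) \<le> Q * r powr t"
        if n: "n \<ge> N" for n x
      proof -
        have "c ^ n \<le> c ^ N" using c n by (intro power_decreasing) auto
        then have "c ^ n \<le> r / C" using N by simp
        then have "C * c ^ n \<le> r" using C by (simp add: field_simps)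
        from hit[OF r this, of x] show ?thesis
          unfolding sum_divide_distrib[symmetric] using Zpos[of 1 n] by (simp add: pos_divide_le_eq)
      qed
      then show ?thesis by blast
    qed
  qed (use t W_fin K a z C in \<open>auto simp: Q_def Z_nonneg\<close>)
qed

end

section \<open>Pressure\<close>

lemma scaled_ln_ennreal_le_iff:
  assumes "k > 0"
  shows "ereal (1 / real k) * ln_ennreal Z \<le> ereal x \<longleftrightarrow> Z \<le> ennreal (exp (x * real k))"
proof (cases Z)
  case (real r)
  show ?thesis
  proof (cases "r = 0")
    case False
    then have r: "r > 0" using real by simp
    have "ereal (1 / real k) * ln_ennreal Z \<le> ereal x \<longleftrightarrow> ln r \<le> x * real k"
      using real r assms by (simp add: ln_ennreal_def ennreal_eq_0_iff field_simps)
    also have "\<dots> \<longleftrightarrow> r \<le> exp (x * real k)"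
      using r exp_le_cancel_iff[of "ln r" "x * real k"] by simp
    finally show ?thesis using real by (simp add: ennreal_le_iff)
  qed (use real assms in \<open>simp add: ln_ennreal_def\<close>)
qed (use assms in \<open>simp add: ln_ennreal_def top_unique\<close>)

lemma scaled_ln_ennreal_ge_iff:
  assumes "k > 0"
  shows "ereal x \<le> ereal (1 / real k) * ln_ennreal Z \<longleftrightarrow> ennreal (exp (x * real k)) \<le> Z"
proof (cases Z)
  case (real r)
  show ?thesis
  proof (cases "r = 0")
    case False
    then have r: "r > 0" using real by simp
    have "ereal x \<le> ereal (1 / real k) * ln_ennreal Z \<longleftrightarrow> x * real k \<le> ln r"
      using real r assms by (simp add: ln_ennreal_def ennreal_eq_0_iff field_simps)
    also have "\<dots> \<longleftrightarrow> exp (x * real k) \<le> r" using r by (simp add: ln_ge_iff)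
    finally show ?thesis using real by (simp add: ennreal_le_iff)
  qed (use real assms in \<open>simp add: ln_ennreal_def ennreal_eq_0_iff\<close>)
qed (use assms in \<open>simp add: ln_ennreal_def\<close>)

lemma exponential_lower_bound:
  fixes f :: "nat \<Rightarrow> real"
  assumes pos: "\<And>n. f n > 0" and b: "b > 0" and ev: "\<forall>\<^sub>F n in sequentially. b * exp (\<gamma> * real n) \<le> f n"
  obtains a where "a > 0" "\<And>n. a * exp (\<gamma> * real n) \<le> f n"
proof -
  obtain N where N: "\<And>n. n \<ge> N \<Longrightarrow> b * exp (\<gamma> * real n) \<le> f n"
    using ev by (auto simp: eventually_sequentially)
  define a where "a = Min (insert b ((\<lambda>n. f n / exp (\<gamma> * real n)) ` {..<N}))"
  have "a > 0" using pos b by (auto simp: a_def)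
  moreover have "a * exp (\<gamma> * real n) \<le> f n" for n
  proof (cases "n < N")
    case True
    then have "a \<le> f n / exp (\<gamma> * real n)" by (auto simp: a_def)
    then show ?thesis by (simp add: pos_le_divide_eq)
  next
    case False
    have "a \<le> b" by (auto simp: a_def)
    then have "a * exp (\<gamma> * real n) \<le> b * exp (\<gamma> * real n)" by (intro mult_right_mono) auto
    then show ?thesis using N[of n] False by linarith
  qed
  ultimately show thesis by (rule that)
qed

text \<open>
  Beyond some \<open>N\<close> each factor is at most \<open>exp \<epsilon>\<close>; the first \<open>N\<close> factors give \<open>K\<close>.
\<close>

lemma prod_subexponential:
  fixes e :: "nat \<Rightarrow> real"
  assumes e: "\<And>j. e j \<ge> 0" "e \<longlonglongrightarrow> 0" and \<epsilon>: "\<epsilon> > 0"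
  obtains K where "K > 0" "\<And>n. (\<Prod>j\<in>{1..n}. 1 + e j) \<le> K * exp (\<epsilon> * real n)"
proof -
  have "\<forall>\<^sub>F j in sequentially. e j < \<epsilon>" using e(2) \<epsilon> by (rule order_tendstoD)
  then obtain N where N: "\<And>j. j \<ge> N \<Longrightarrow> e j < \<epsilon>" by (auto simp: eventually_sequentially)
  define K where "K = (\<Prod>j<N. 1 + e j)"
  have K1: "K \<ge> 1" unfolding K_def using e by (intro prod_ge_1) simp
  have "(\<Prod>j\<in>{1..n}. 1 + e j) \<le> K * exp (\<epsilon> * real n)" for n
  proof -
    have "(\<Prod>j\<in>{1..n}. 1 + e j) = (\<Prod>j\<in>{1..n} \<inter> {..<N}. 1 + e j) * (\<Prod>j\<in>{1..n} - {..<N}. 1 + e j)"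
      by (rule prod.Int_Diff) simp
    also have "\<dots> \<le> K * exp (\<epsilon> * real n)"
    proof (rule mult_mono)
      show "(\<Prod>j\<in>{1..n} \<inter> {..<N}. 1 + e j) \<le> K"
        unfolding K_def using e by (intro prod_mono2) auto
      have "(\<Prod>j\<in>{1..n} - {..<N}. 1 + e j) \<le> (\<Prod>j\<in>{1..n} - {..<N}. exp \<epsilon>)"
      proof (rule prod_mono)
        fix j assume "j \<in> {1..n} - {..<N}"
        then have "e j < \<epsilon>" by (intro N) auto
        then show "0 \<le> 1 + e j \<and> 1 + e j \<le> exp \<epsilon>"
          using e(1)[of j] exp_ge_add_one_self[of \<epsilon>] by linarith
      qed
      also have "\<dots> = exp \<epsilon> ^ card ({1..n} - {..<N})" by simp
      also have "\<dots> \<le> exp \<epsilon> ^ n"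
        using \<epsilon> card_mono[of "{1..n}" "{1..n} - {..<N}"] by (intro power_increasing) auto
      also have "\<dots> = exp (\<epsilon> * real n)" by (simp add: exp_of_nat_mult[symmetric] mult.commute)
      finally show "(\<Prod>j\<in>{1..n} - {..<N}. 1 + e j) \<le> exp (\<epsilon> * real n)" .
    qed (use K1 e in \<open>auto intro!: prod_nonneg add_nonneg_nonneg\<close>)
    finally show ?thesis .
  qed
  then show thesis using that[of K] K1 by simp
qed

context conformal_ifs
begin

text \<open>
  The partition function of the full system, which may be infinite.
\<close>

definition Z_inf :: "real \<Rightarrow> nat \<Rightarrow> ennreal" where
  "Z_inf t k = (\<Sum>\<^sub>\<infinity>u\<in>words 1 k. ennreal (q 1 u powr t))"

lemma lower_pressure_Z_inf:
  "lower_pressure J \<phi> t = liminf (\<lambda>k. ereal (1 / real k) * ln_ennreal (Z_inf t k))"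
  by (simp add: lower_pressure_def Z_inf_def q_def)

lemma Z_inf_SUP:
  "Z_inf t k = (SUP F\<in>{F. finite F \<and> F \<subseteq> words 1 k}. ennreal (\<Sum>u\<in>F. q 1 u powr t))"
  unfolding Z_inf_def by (subst nonneg_infsum_complete) (auto simp: sum_ennreal)

lemma Z_inf_le:
  "(\<And>F. finite F \<Longrightarrow> F \<subseteq> words 1 k \<Longrightarrow> (\<Sum>u\<in>F. q 1 u powr t) \<le> b) \<Longrightarrow> Z_inf t k \<le> ennreal b"
  unfolding Z_inf_SUP by (intro SUP_least ennreal_leI) auto

lemma Z_inf_ge:
  "finite F \<Longrightarrow> F \<subseteq> words 1 k \<Longrightarrow> ennreal (\<Sum>u\<in>F. q 1 u powr t) \<le> Z_inf t k"
  unfolding Z_inf_SUP by (intro SUP_upper) auto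

lemma finite_sum_le_of_Z_inf_le:
  assumes "Z_inf t k \<le> ennreal b" "b \<ge> 0" "finite F" "F \<subseteq> words 1 k"
  shows "(\<Sum>u\<in>F. q 1 u powr t) \<le> b"
  using order_trans[OF Z_inf_ge[OF assms(3,4)] assms(1)] assms(2) by (simp add: ennreal_le_iff)

lemma lower_pressure_geI:
  assumes "\<forall>\<^sub>F k in sequentially. ennreal (exp (x * real k)) \<le> Z_inf t k"
  shows "ereal x \<le> lower_pressure J \<phi> t"
  unfolding lower_pressure_Z_inf
proof (rule Liminf_bounded)
  show "\<forall>\<^sub>F k in sequentially. ereal x \<le> ereal (1 / real k) * ln_ennreal (Z_inf t k)"
    using assms eventually_gt_at_top[of 0]
    by eventually_elim (simp add: scaled_ln_ennreal_ge_iff)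
qed

lemma lower_pressure_leI:
  assumes "\<forall>\<^sub>F k in sequentially. Z_inf t k \<le> ennreal (exp (x * real k))"
  shows "lower_pressure J \<phi> t \<le> ereal x"
proof -
  have "lower_pressure J \<phi> t \<le> limsup (\<lambda>k. ereal (1 / real k) * ln_ennreal (Z_inf t k))"
    unfolding lower_pressure_Z_inf by (rule Liminf_le_Limsup) simp
  also have "\<dots> \<le> ereal x"
  proof (rule Limsup_bounded)
    show "\<forall>\<^sub>F k in sequentially. ereal (1 / real k) * ln_ennreal (Z_inf t k) \<le> ereal x"
      using assms eventually_gt_at_top[of 0]
      by eventually_elim (simp add: scaled_ln_ennreal_le_iff)
  qed
  finally show ?thesis .
qed

lemma lower_pressure_greaterD:
  assumes "ereal x < lower_pressure J \<phi> t"
  shows "\<forall>\<^sub>F k in sequentially. ennreal (exp (x * real k)) < Z_inf t k"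
proof -
  have "\<forall>\<^sub>F k in sequentially. ereal x < ereal (1 / real k) * ln_ennreal (Z_inf t k)"
    using less_LiminfD[OF assms[unfolded lower_pressure_Z_inf]] .
  then show ?thesis
    using eventually_gt_at_top[of 0]
    by eventually_elim (simp only: scaled_ln_ennreal_le_iff not_le[symmetric] not_False_eq_True)
qed

lemma lower_pressure_negD:
  assumes "lower_pressure J \<phi> t < 0"
  obtains y where "y < 0" "\<exists>\<^sub>F k in sequentially. Z_inf t k \<le> ennreal (exp (y * real k))"
proof -
  obtain y where y: "lower_pressure J \<phi> t < ereal y" "ereal y < 0"
    using ereal_dense2[OF assms] by auto
  have "\<exists>\<^sub>F k in sequentially. Z_inf t k \<le> ennreal (exp (y * real k))"
    unfolding frequently_def
  proof
    assume "\<forall>\<^sub>F k in sequentially. \<not> Z_inf t k \<le> ennreal (exp (y * real k))"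
    then have "ereal y \<le> lower_pressure J \<phi> t"
      by (intro lower_pressure_geI) (auto elim: eventually_mono)
    with y show False by simp
  qed
  with y that[of y] show thesis by simp
qed

lemma words_1D: "u \<in> words 1 k \<Longrightarrow> length u = k \<and> set u \<subseteq> {1..}"
  by (simp add: words_def)

text \<open>
  Since \<open>q 1 u \<le> C * c ^ k\<close> for words of length \<open>k\<close>, raising the exponent from \<open>s\<close> to \<open>t\<close> gains the factor
  \<open>(C * c ^ k) powr (t - s)\<close>, written here as an exponential.
\<close>

lemma sum_powr_shift:
  assumes st: "s \<le> t" and F: "finite F" "F \<subseteq> words 1 k"
  shows "(\<Sum>u\<in>F. q 1 u powr t) \<le> exp ((t - s) * (ln C + ln c * real k)) * (\<Sum>u\<in>F. q 1 u powr s)"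
  unfolding sum_distrib_left
proof (rule sum_mono)
  fix u assume "u \<in> F"
  then have u: "length u = k" "set u \<subseteq> {1..}" using F words_1D by blast+
  have pos: "q 1 u > 0" using deriv_norm_q(4) u by simp
  have "q 1 u powr (t - s) \<le> (C * c ^ k) powr (t - s)"
    using q_le_power[of 1 u] u pos st by (intro powr_mono2) auto
  also have "\<dots> = exp ((t - s) * (ln C + ln c * real k))"
    using C c by (simp add: powr_def ln_mult ln_realpow mult.commute)
  finally have "q 1 u powr (t - s) * q 1 u powr s \<le> exp ((t - s) * (ln C + ln c * real k)) * q 1 u powr s"
    by (intro mult_right_mono) auto
  then show "q 1 u powr t \<le> exp ((t - s) * (ln C + ln c * real k)) * q 1 u powr s"
    using pos by (simp add: powr_add[symmetric])
qed

text \<open>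
  Lowering the exponent from \<open>t\<close> to \<open>s\<close> raises the pressure by at least \<open>(t - s) * (- ln c)\<close>, since
  \<open>q 1 u\<close> is at most \<open>C * c ^ k\<close> for words of length \<open>k\<close>.
\<close>

lemma lower_pressure_pos:
  assumes st: "s < t" and t: "0 \<le> lower_pressure J \<phi> t"
  shows "0 < lower_pressure J \<phi> s"
proof -
  \<comment> \<open>of the gain \<open>3 * \<delta>\<close>, one third absorbs the slack in \<open>0 \<le> P(t)\<close>, one third the constant \<open>C\<close>\<close>
  define \<delta> where "\<delta> = (t - s) * (- ln c) / 3"
  have \<delta>: "\<delta> > 0" using st c by (simp add: \<delta>_def ln_less_zero mult_pos_neg)
  have "ereal (- \<delta>) < lower_pressure J \<phi> t"
    using \<delta> by (intro less_le_trans[OF _ t]) simp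
  then have "\<forall>\<^sub>F k in sequentially. ennreal (exp (- \<delta> * real k)) < Z_inf t k"
    by (rule lower_pressure_greaterD)
  moreover have "\<forall>\<^sub>F k in sequentially. (t - s) * ln C \<le> \<delta> * real k"
    using \<delta> by real_asymp
  ultimately have "\<forall>\<^sub>F k in sequentially. ennreal (exp (\<delta> * real k)) \<le> Z_inf s k"
  proof eventually_elim
    case (elim k)
    obtain F where F: "finite F" "F \<subseteq> words 1 k" "ennreal (exp (- \<delta> * real k)) < ennreal (\<Sum>u\<in>F. q 1 u powr t)"
      using elim(1) unfolding Z_inf_SUP less_SUP_iff by auto
    have "exp (- \<delta> * real k) \<le> (\<Sum>u\<in>F. q 1 u powr t)"
      using F(3) by (simp add: ennreal_less_iff)
    also have "\<dots> \<le> exp ((t - s) * (ln C + ln c * real k)) * (\<Sum>u\<in>F. q 1 u powr s)"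
      using st F by (intro sum_powr_shift) auto
    also have "\<dots> \<le> exp (- 2 * \<delta> * real k) * (\<Sum>u\<in>F. q 1 u powr s)"
      using elim(2) by (intro mult_right_mono sum_nonneg) (auto simp: \<delta>_def algebra_simps)
    finally have "exp (2 * \<delta> * real k) * exp (- \<delta> * real k)
        \<le> exp (2 * \<delta> * real k) * (exp (- 2 * \<delta> * real k) * (\<Sum>u\<in>F. q 1 u powr s))"
      by (intro mult_left_mono) auto
    then have "exp (\<delta> * real k) \<le> (\<Sum>u\<in>F. q 1 u powr s)"
      by (simp add: mult.assoc[symmetric] exp_add[symmetric])
    then show ?case
      using order_trans[OF ennreal_leI Z_inf_ge[OF F(1,2), of s]] by simp
  qed
  then have "ereal \<delta> \<le> lower_pressure J \<phi> s" by (rule lower_pressure_geI)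
  then show ?thesis using \<delta> by (simp add: less_le_trans[of 0 "ereal \<delta>"])
qed

text \<open>
  At \<open>t = DIM('a)\<close> the partition functions are bounded, by packing; above it they decay exponentially.
\<close>

lemma lower_pressure_neg_above_dim:
  assumes t: "t > real DIM('a)"
  shows "lower_pressure J \<phi> t < 0"
proof -
  let ?d = "real DIM('a)"
  obtain K where K: "K > 0" "\<And>H n. finite H \<Longrightarrow> (\<And>u. u \<in> H \<Longrightarrow> set u \<subseteq> {1..} \<and> length u = n) \<Longrightarrow>
      (\<Sum>u\<in>H. q 1 u ^ DIM('a)) \<le> K"
    using sum_q_power_dim by blast
  define \<delta> where "\<delta> = (t - ?d) * (- ln c) / 2"
  have \<delta>: "\<delta> > 0" using t c by (simp add: \<delta>_def ln_less_zero mult_pos_neg)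
  have "\<forall>\<^sub>F k in sequentially. (t - ?d) * ln C + ln K \<le> \<delta> * real k"
    using \<delta> by real_asymp
  then have "\<forall>\<^sub>F k in sequentially. Z_inf t k \<le> ennreal (exp (- \<delta> * real k))"
  proof eventually_elim
    case (elim k)
    show ?case
    proof (rule Z_inf_le)
      fix F assume F: "finite F" "F \<subseteq> words 1 k"
      have "(\<Sum>u\<in>F. q 1 u powr ?d) = (\<Sum>u\<in>F. q 1 u ^ DIM('a))"
      proof (rule sum.cong[OF refl])
        fix u assume "u \<in> F"
        then have "q 1 u > 0" using F words_1D[of u k] deriv_norm_q(4)[of 1 u] by auto
        then show "q 1 u powr ?d = q 1 u ^ DIM('a)" by (rule powr_realpow)
      qed
      also have "\<dots> \<le> K"
        using F words_1D by (intro K(2)[of F k]) blast+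
      finally have 1: "(\<Sum>u\<in>F. q 1 u powr ?d) \<le> K" .
      have "(\<Sum>u\<in>F. q 1 u powr t) \<le> exp ((t - ?d) * (ln C + ln c * real k)) * (\<Sum>u\<in>F. q 1 u powr ?d)"
        using t F by (intro sum_powr_shift) auto
      also have "\<dots> \<le> exp ((t - ?d) * (ln C + ln c * real k)) * exp (ln K)"
        using 1 K(1) by (intro mult_left_mono) auto
      also have "\<dots> \<le> exp (- \<delta> * real k)"
      proof -
        have "(t - ?d) * (ln c * real k) = - 2 * \<delta> * real k" by (simp add: \<delta>_def)
        then show ?thesis
          unfolding exp_add[symmetric] distrib_left using elim by simp
      qed
      finally show "(\<Sum>u\<in>F. q 1 u powr t) \<le> exp (- \<delta> * real k)" .
    qed
  qed
  then have "lower_pressure J \<phi> t \<le> ereal (- \<delta>)" by (rule lower_pressure_leI)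
  also have "\<dots> < 0" using \<delta> by simp
  finally show ?thesis .
qed

text \<open>
  For \<open>t \<le> 0\<close> a single word of length \<open>k\<close> already contributes at least 1, once \<open>C * c ^ k < 1\<close>.
\<close>

lemma lower_pressure_nonneg:
  assumes t: "t \<le> 0"
  shows "0 \<le> lower_pressure J \<phi> t"
proof -
  have "(\<lambda>k. C * c ^ k) \<longlonglongrightarrow> C * 0"
    using c by (intro tendsto_mult tendsto_const LIMSEQ_power_zero) auto
  then have "\<forall>\<^sub>F k in sequentially. C * c ^ k < 1" by (intro order_tendstoD) auto
  then have "\<forall>\<^sub>F k in sequentially. ennreal (exp (0 * real k)) \<le> Z_inf t k"
  proof eventually_elim
    case (elim k)
    define u where "u = replicate k (1::nat)"
    have u: "set u \<subseteq> {1..}" "length u = k" by (auto simp: u_def)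
    have "q 1 u > 0" "q 1 u \<le> 1"
      using deriv_norm_q(4)[of 1 u] q_le_power[of 1 u] u elim by auto
    then have "1 \<le> q 1 u powr t" using powr_mono'[of t 0 "q 1 u"] t by simp
    also have "\<dots> = (\<Sum>u\<in>{u}. q 1 u powr t)" by simp
    finally have "ennreal 1 \<le> ennreal (\<Sum>u\<in>{u}. q 1 u powr t)" by (rule ennreal_leI)
    also have "\<dots> \<le> Z_inf t k" using u by (intro Z_inf_ge) (auto simp: words_def)
    finally show ?case by simp
  qed
  from lower_pressure_geI[OF this] show ?thesis by (simp add: zero_ereal_def)
qed

section \<open>The two bounds for the dimension\<close>

text \<open>
  The pieces of one level cover the attractor and have diameter at most \<open>L * q 1 u\<close>. A negative lower pressure
  makes the partition function exponentially small at infinitely many levels.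
\<close>

lemma hausdorff_measure_attractor_zero:
  assumes neg: "lower_pressure J \<phi> t < 0"
  shows "0 < t" "hausdorff_measure t (attractor Jw) = 0"
proof -
  show t: "0 < t" using neg lower_pressure_nonneg[of t] by (meson not_le)
  obtain y where y: "y < 0" "\<exists>\<^sub>F k in sequentially. Z_inf t k \<le> ennreal (exp (y * real k))"
    using lower_pressure_negD[OF neg] .
  obtain L where L: "L > 0" "\<And>u. set u \<subseteq> {1..} \<Longrightarrow> diameter (Jw u) \<le> L * q 1 u"
    using diameter_Jw by blast
  show "hausdorff_measure t (attractor Jw) = 0"
  proof (rule hausdorff_measure_eq_0I[OF t, where P = Jw])
    fix \<delta> \<epsilon> :: real assume \<delta>: "\<delta> > 0" and \<epsilon>: "\<epsilon> > 0"
    have "(\<lambda>k. L * (C * c ^ k)) \<longlonglongrightarrow> L * (C * 0)"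
      using c by (intro tendsto_mult tendsto_const LIMSEQ_power_zero) auto
    then have "\<forall>\<^sub>F k in sequentially. L * (C * c ^ k) < \<delta>" using \<delta> by (intro order_tendstoD) auto
    moreover have "\<forall>\<^sub>F k in sequentially. L powr t * exp (y * real k) < \<epsilon>"
    proof -
      have "(\<lambda>k. L powr t * exp (y * real k)) \<longlonglongrightarrow> 0" using y(1) by real_asymp
      then show ?thesis using \<epsilon> by (rule order_tendstoD)
    qed
    moreover have "\<forall>\<^sub>F k::nat in sequentially. k \<ge> 1" by (rule eventually_ge_at_top)
    ultimately have "\<forall>\<^sub>F k in sequentially. L * (C * c ^ k) < \<delta> \<and> L powr t * exp (y * real k) < \<epsilon> \<and> k \<ge> 1"
      by eventually_elim simp
    from frequently_eventually_conj[OF y(2) this]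
    obtain k where k: "L * (C * c ^ k) < \<delta>" "L powr t * exp (y * real k) < \<epsilon>" "k \<ge> 1"
      "Z_inf t k \<le> ennreal (exp (y * real k))"
      by (auto dest!: frequently_ex)
    have diam: "0 \<le> diameter (Jw u) \<and> diameter (Jw u) \<le> L * q 1 u \<and> q 1 u > 0" if "u \<in> words 1 k" for u
      using words_1D[OF that] L(2) deriv_norm_q(4)[of 1 u] Jw_nonempty_compact(2)[of u]
      by (auto intro: diameter_ge_0 compact_imp_bounded)
    show "\<exists>W. countable W \<and> attractor Jw \<subseteq> (\<Union>u\<in>W. Jw u) \<and>
        (\<forall>u\<in>W. bounded (Jw u) \<and> diameter (Jw u) \<le> \<delta>) \<and>
        (\<forall>F. finite F \<longrightarrow> F \<subseteq> W \<longrightarrow> (\<Sum>u\<in>F. diameter (Jw u) powr t) \<le> \<epsilon>)"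
    proof (intro exI[of _ "words 1 k"] conjI ballI allI impI)
      show "countable (words 1 k)" by (rule countableI_type)
      show "attractor Jw \<subseteq> (\<Union>u\<in>words 1 k. Jw u)"
        unfolding attractor_def using k(3) by (intro INF_lower) auto
    next
      fix u assume u: "u \<in> words 1 k"
      show "bounded (Jw u)"
        using words_1D[OF u] Jw_nonempty_compact(2)[of u] by (simp add: compact_imp_bounded)
      have "diameter (Jw u) \<le> L * q 1 u" using diam[OF u] by simp
      also have "\<dots> \<le> L * (C * c ^ k)"
        using L(1) q_le_power[of 1 u] words_1D[OF u] by (intro mult_left_mono) auto
      finally show "diameter (Jw u) \<le> \<delta>" using k(1) by simp
    next
      fix F assume F: "finite F" "F \<subseteq> words 1 k"
      have "(\<Sum>u\<in>F. diameter (Jw u) powr t) \<le> (\<Sum>u\<in>F. (L * q 1 u) powr t)"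
        using diam F t by (intro sum_mono powr_mono2) auto
      also have "\<dots> = L powr t * (\<Sum>u\<in>F. q 1 u powr t)"
        unfolding sum_distrib_left using diam F L(1)
        by (intro sum.cong) (auto simp: powr_mult less_imp_le)
      also have "\<dots> \<le> L powr t * exp (y * real k)"
        using k(4) F by (intro mult_left_mono finite_sum_le_of_Z_inf_le) auto
      finally show "(\<Sum>u\<in>F. diameter (Jw u) powr t) \<le> \<epsilon>" using k(2) by simp
    qed
  qed
qed

lemma finite_words_bounded_letters:
  assumes "finite F" "F \<subseteq> words 1 n"
  obtains N where "F \<subseteq> alphabet_words (\<lambda>_. {1..N}) 1 n"
proof -
  define N where "N = Max (insert 0 (\<Union>u\<in>F. set u))"
  have "F \<subseteq> alphabet_words (\<lambda>_. {1..N}) 1 n"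
  proof
    fix u assume u: "u \<in> F"
    have "i \<le> N" if "i \<in> set u" for i
      unfolding N_def using assms(1) u that by (intro Max_ge) auto
    moreover have "length u = n \<and> set u \<subseteq> {1..}"
      using words_1D[of u n] assms(2) u by blast
    ultimately show "u \<in> alphabet_words (\<lambda>_. {1..N}) 1 n"
      unfolding alphabet_words_const by fastforce
  qed
  then show thesis by (rule that)
qed

lemma alphabet_words_mono:
  "(\<And>j. A j \<subseteq> B j) \<Longrightarrow> alphabet_words A l n \<subseteq> alphabet_words B l n"
proof (induction n arbitrary: l)
  case (Suc n)
  then show ?case by (simp add: image_mono Sigma_mono)
qed simp

text \<open>
  If almost the whole of each one-letter sum comes from \<open>A n\<close>, the truncation changes the partition function by a
  subexponential factor only. The full partition function is approached through finite alphabets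
  \<open>B j = A j \<union> {1..N}\<close>, and the truncation errors \<open>e j\<close> do not depend on \<open>N\<close>.
\<close>

lemma truncated_growth_summable:
  fixes A :: "nat \<Rightarrow> nat set"
  assumes t: "t > 0" and A: "\<And>j. finite (A j)" "\<And>j. A j \<noteq> {}" "\<And>j. A j \<subseteq> {1..}"
    and summ: "\<And>n. n \<ge> 1 \<Longrightarrow> (\<lambda>k. q n [k] powr t) summable_on {1..}"
    and ratio: "(\<lambda>n. (\<Sum>k\<in>A n. q n [k] powr t) / (\<Sum>\<^sub>\<infinity>k\<in>{1..}. q n [k] powr t)) \<longlonglongrightarrow> 1"
    and P: "ereal \<gamma> < lower_pressure J \<phi> t" and \<epsilon>: "\<epsilon> > 0"
  obtains b where "b > 0" "\<forall>\<^sub>F n in sequentially. b * exp ((\<gamma> - \<epsilon>) * real n) \<le> Z A t 1 n"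
proof -
  let ?x = "\<lambda>n k. q n [k] powr t"
  define T where "T n = (\<Sum>k\<in>A n. ?x n k)" for n
  define S where "S n = (\<Sum>\<^sub>\<infinity>k\<in>{1..}. ?x n k)" for n
  have Tpos: "T n > 0" if "n \<ge> 1" for n
    unfolding T_def
  proof (rule sum_pos)
    fix k assume "k \<in> A n"
    then have "q n [k] > 0" using A(3) that deriv_norm_q(4)[of n "[k]"] by auto
    then show "?x n k > 0" by simp
  qed (use A in auto)
  have sum_le: "(\<Sum>k\<in>F. ?x n k) \<le> S n" if "finite F" "F \<subseteq> {1..}" "n \<ge> 1" for F n
    unfolding S_def using that by (intro finite_sum_le_infsum summ) auto
  have TS: "T n \<le> S n" if "n \<ge> 1" for n
    unfolding T_def using A that by (intro sum_le) auto
  \<comment> \<open>the bound that \<open>Z_truncation\<close> asks for when all letters outside \<open>A n\<close> are discarded; the system has no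
     level 0, and the value there only has to be nonnegative\<close>
  define e where "e n = (if n = 0 then 0 else C powr (2 * t) * (S n / T n - 1))" for n
  have e0: "e n \<ge> 0" for n
    using TS[of n] Tpos[of n] by (auto simp: e_def)
  have "(\<lambda>n. C powr (2 * t) * (inverse (T n / S n) - 1)) \<longlonglongrightarrow> C powr (2 * t) * (inverse 1 - 1)"
    using ratio unfolding T_def[symmetric] S_def[symmetric] by (intro tendsto_intros) auto
  moreover have "\<forall>\<^sub>F n in sequentially. C powr (2 * t) * (inverse (T n / S n) - 1) = e n"
    using eventually_gt_at_top[of 0] by eventually_elim (simp add: e_def)
  ultimately have "e \<longlonglongrightarrow> C powr (2 * t) * (inverse 1 - 1)"
    by (rule Lim_transform_eventually)
  then have e_lim: "e \<longlonglongrightarrow> 0" by simp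
  obtain K where K: "K > 0" "\<And>n. (\<Prod>j\<in>{1..n}. 1 + e j) \<le> K * exp (\<epsilon> * real n)"
    using prod_subexponential[OF e0 e_lim \<epsilon>] by blast
  have trunc: "Z_inf t n \<le> ennreal (K * exp (\<epsilon> * real n) * Z A t 1 n)" for n
  proof (rule Z_inf_le)
    fix F assume F: "finite F" "F \<subseteq> words 1 n"
    obtain N where N: "F \<subseteq> alphabet_words (\<lambda>_. {1..N}) 1 n"
      using finite_words_bounded_letters[OF F] .
    define B where "B j = A j \<union> {1..N}" for j
    have B: "\<And>j. finite (B j)" "\<And>j. A j \<subseteq> B j" "\<And>j. B j \<subseteq> {1..}"
      using A by (auto simp: B_def)
    have "F \<subseteq> alphabet_words B 1 n"
      using N alphabet_words_mono[of "\<lambda>_. {1..N}" B 1 n] by (auto simp: B_def)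
    then have "(\<Sum>u\<in>F. q 1 u powr t) \<le> Z B t 1 n"
      unfolding Z_def using B(1) by (intro sum_mono2 finite_alphabet_words) auto
    also have "\<dots> \<le> (\<Prod>j\<in>{1..n}. 1 + e j) * Z A t 1 n"
    proof (rule Z_truncation[OF _ B e0])
      fix j :: nat assume j: "j \<ge> 1"
      have "(\<Sum>i\<in>B j - A j. ?x j i) + T j = (\<Sum>i\<in>B j. ?x j i)"
        unfolding T_def by (rule sum.subset_diff[OF B(2,1), symmetric])
      also have "\<dots> \<le> S j" using B j by (intro sum_le)
      finally have "C powr (2 * t) * (\<Sum>i\<in>B j - A j. ?x j i) \<le> C powr (2 * t) * (S j - T j)"
        by (intro mult_left_mono) auto
      also have "\<dots> = e j * T j"
        using Tpos[OF j] j by (simp add: e_def field_simps)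
      finally show "C powr (2 * t) * (\<Sum>i\<in>B j - A j. ?x j i) \<le> e j * (\<Sum>i\<in>A j. ?x j i)"
        by (simp add: T_def)
    qed (use t in auto)
    also have "\<dots> \<le> K * exp (\<epsilon> * real n) * Z A t 1 n"
      using K(2) by (intro mult_right_mono Z_nonneg)
    finally show "(\<Sum>u\<in>F. q 1 u powr t) \<le> K * exp (\<epsilon> * real n) * Z A t 1 n" .
  qed
  have "\<forall>\<^sub>F n in sequentially. 1 / K * exp ((\<gamma> - \<epsilon>) * real n) \<le> Z A t 1 n"
    using lower_pressure_greaterD[OF P]
  proof eventually_elim
    case (elim n)
    have "ennreal (exp (\<gamma> * real n)) \<le> ennreal (K * exp (\<epsilon> * real n) * Z A t 1 n)"
      using elim trunc[of n] by simp
    then have "exp (\<gamma> * real n) \<le> K * exp (\<epsilon> * real n) * Z A t 1 n"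
      using K(1) Z_nonneg by (simp add: ennreal_le_iff)
    then show ?case
      using K(1) by (simp add: left_diff_distrib exp_diff field_simps)
  qed
  then show thesis using that[of "1 / K"] K(1) by simp
qed

text \<open>
  Each further letter multiplies the partition function by at least the one-letter sum divided by \<open>C powr t\<close>,
  which tends to infinity.
\<close>

lemma truncated_growth_divergent:
  fixes A :: "nat \<Rightarrow> nat set"
  assumes t: "t > 0" and A: "\<And>j. finite (A j)" "\<And>j. A j \<noteq> {}" "\<And>j. A j \<subseteq> {1..}"
    and lim: "filterlim (\<lambda>n. \<Sum>k\<in>A n. q n [k] powr t) at_top sequentially"
  obtains b where "b > 0" "\<forall>\<^sub>F n in sequentially. b * exp (\<gamma> * real n) \<le> Z A t 1 n"
proof -
  have pos: "Z A t 1 n > 0" for n using Z_pos A by simp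
  have T: "Z A t n 1 = (\<Sum>k\<in>A n. q n [k] powr t)" for n
    unfolding Z_def One_nat_def sum_alphabet_words_Suc by simp
  have "\<forall>\<^sub>F n in sequentially. C powr t * exp \<gamma> \<le> (\<Sum>k\<in>A n. q n [k] powr t)"
    using lim by (simp add: filterlim_at_top)
  then obtain N where N: "\<And>n. n \<ge> N \<Longrightarrow> C powr t * exp \<gamma> \<le> Z A t n 1"
    unfolding eventually_sequentially T by blast
  have step: "exp \<gamma> * Z A t 1 n \<le> Z A t 1 (Suc n)" if "n \<ge> N" for n
  proof -
    have "C powr t * (exp \<gamma> * Z A t 1 n) \<le> Z A t 1 n * Z A t (1 + n) 1"
      using mult_left_mono[OF N[of "1 + n"], of "Z A t 1 n"] that Z_nonneg by (simp add: mult_ac)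
    also have "\<dots> \<le> C powr t * Z A t 1 (n + 1)"
      using A t by (intro Z_supermultiplicative) auto
    finally show ?thesis using C by simp
  qed
  define b where "b = Z A t 1 N / exp (\<gamma> * real N)"
  have "b * exp (\<gamma> * real n) \<le> Z A t 1 n" if "n \<ge> N" for n
    using that
  proof (induction n rule: dec_induct)
    case base
    then show ?case by (simp add: b_def)
  next
    case (step n)
    have "b * exp (\<gamma> * real (Suc n)) = exp \<gamma> * (b * exp (\<gamma> * real n))"
      by (simp add: distrib_left exp_add mult_ac)
    also have "\<dots> \<le> exp \<gamma> * Z A t 1 n" using step.IH by simp
    also have "\<dots> \<le> Z A t 1 (Suc n)" using step.hyps \<open>\<And>n. n \<ge> N \<Longrightarrow> exp \<gamma> * Z A t 1 n \<le> Z A t 1 (Suc n)\<close> by simp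
    finally show ?case .
  qed
  then have "\<forall>\<^sub>F n in sequentially. b * exp (\<gamma> * real n) \<le> Z A t 1 n"
    by (auto simp: eventually_sequentially)
  then show thesis using that[of b] pos by (simp add: b_def)
qed

end

theorem corollary8p1:
  fixes J :: "'a::euclidean_space set"
    and \<phi> :: "nat \<Rightarrow> nat \<Rightarrow> 'a \<Rightarrow> 'a"
    and Jw :: "nat list \<Rightarrow> 'a set"
    and m M :: real
  assumes ifs: "nonauto_ifs J \<phi> Jw"
    and conformal: "conformal_system J \<phi>"
    and decreasing: "\<And>n. n \<ge> 1 \<Longrightarrow> antimono_on {1..} (\<lambda>k. sup_deriv_norm J (\<phi> n k))"
    and osc: "open_set_condition Jw"
    and cone: "cone_condition J"
    and m: "m_pressure J \<phi> = ereal m" "m > 0"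
    and M: "0 < M" "M < 1"
    and dichotomy: "\<And>t. 0 < t \<Longrightarrow> t < real DIM('a) \<Longrightarrow>
        (\<forall>n\<ge>1. \<not> (\<lambda>k. sup_deriv_norm J (\<phi> n k) powr t) summable_on {1..}) \<or>
        (\<forall>n\<ge>1. (\<lambda>k. sup_deriv_norm J (\<phi> n k) powr t) summable_on {1..})"
    and finite_case: "\<And>t. 0 < t \<Longrightarrow> t < real DIM('a) \<Longrightarrow>
        (\<forall>n\<ge>1. (\<lambda>k. sup_deriv_norm J (\<phi> n k) powr t) summable_on {1..}) \<Longrightarrow>
        (\<lambda>n. (\<Sum>k | 1 \<le> k \<and> real k \<le> exp (M * m * real n). sup_deriv_norm J (\<phi> n k) powr t) /
             (\<Sum>\<^sub>\<infinity>j\<in>{1..}. sup_deriv_norm J (\<phi> n j) powr t)) \<longlonglongrightarrow> 1"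
    and infinite_case: "\<And>t. 0 < t \<Longrightarrow> t < real DIM('a) \<Longrightarrow>
        (\<forall>n\<ge>1. \<not> (\<lambda>k. sup_deriv_norm J (\<phi> n k) powr t) summable_on {1..}) \<Longrightarrow>
        filterlim (\<lambda>n. \<Sum>k | 1 \<le> k \<and> real k \<le> exp (M * m * real n).
                         sup_deriv_norm J (\<phi> n k) powr t) at_top sequentially"
  shows "hausdorff_dim (attractor Jw) = s_lower J \<phi>"
proof -
  have "\<exists>c. 0 < c \<and> c < 1 \<and>
      (\<forall>k\<ge>1. \<forall>i\<ge>1. \<forall>x\<in>J. \<forall>y\<in>J. norm (\<phi> k i x - \<phi> k i y) \<le> c * norm (x - y))"
    using ifs unfolding nonauto_ifs_def by (elim conjE)
  then obtain c where c: "0 < c" "c < 1"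
    "\<forall>k\<ge>1. \<forall>i\<ge>1. \<forall>x\<in>J. \<forall>y\<in>J. norm (\<phi> k i x - \<phi> k i y) \<le> c * norm (x - y)"
    by (elim exE conjE)
  obtain V C where V: "open V" "connected V" "J \<subseteq> V"
      "\<forall>k\<ge>1. \<forall>j\<ge>1. conformal_diffeo_into V (\<phi> k j)"
    and C: "C \<ge> 1" "\<forall>l\<ge>1. \<forall>k\<ge>l. \<forall>u\<in>words l k. \<forall>x\<in>V. \<forall>y\<in>V.
      deriv_norm (word_map \<phi> l u) x \<le> C * deriv_norm (word_map \<phi> l u) y"
    using conformal unfolding conformal_system_def by (elim exE conjE) (rule that)
  have in_words: "u \<in> words 1 (length u)" if "set u \<subseteq> {1..}" for u :: "nat list"
    using that by (simp add: words_def)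
  interpret conformal_ifs J \<phi> Jw V c C
  proof
    show "compact J" "interior J \<noteq> {}" "Jw [] = J" using ifs by (auto simp: nonauto_ifs_def)
    show "\<phi> k i ` J \<subseteq> J" if "k \<ge> 1" "i \<ge> 1" for k i
      using ifs that by (simp add: nonauto_ifs_def)
    show "Jw (u @ [i]) \<subseteq> Jw u" if "set u \<subseteq> {1..}" "i \<ge> 1" for u i
    proof -
      have "\<forall>k\<ge>1. \<forall>u\<in>words 1 (k - 1). \<forall>i\<ge>1. Jw (u @ [i]) \<subseteq> Jw u"
        using ifs by (simp add: nonauto_ifs_def)
      from this[rule_format, of "Suc (length u)" u i] show ?thesis
        using in_words[OF that(1)] that(2) by simp
    qed
    show "\<exists>\<omega>. Jw u = (\<lambda>x. word_map \<phi> 1 u x + \<omega>) ` J" if "set u \<subseteq> {1..}" for u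
    proof -
      have "\<forall>k. \<forall>u\<in>words 1 k. \<exists>\<omega>. Jw u = (\<lambda>x. word_map \<phi> 1 u x + \<omega>) ` J"
        using ifs unfolding nonauto_ifs_def by (elim conjE)
      from this[rule_format, OF in_words[OF that]] show ?thesis .
    qed
    show "deriv_norm (word_map \<phi> l u) x \<le> C * deriv_norm (word_map \<phi> l u) y"
      if "l \<ge> 1" "u \<noteq> []" "set u \<subseteq> {1..}" "x \<in> V" "y \<in> V" for l u x y
    proof -
      have "u \<in> words l (l + length (tl u))"
        using that by (simp add: words_def)
      with C(2) that(1,4,5) show ?thesis by (meson le_add1)
    qed
    show "interior (Jw (u @ [i])) \<inter> interior (Jw (u @ [j])) = {}"
      if "set u \<subseteq> {1..}" "i \<ge> 1" "j \<ge> 1" "i \<noteq> j" for u i j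
      using osc in_words[OF that(1)] that unfolding open_set_condition_def by blast
  qed (use c V C(1) cone in auto)
  have q1: "sup_deriv_norm J (\<phi> n k) = q n [k]" for n k
    by (simp add: q_def)
  show ?thesis
  proof (rule antisym)
    show "hausdorff_dim (attractor Jw) \<le> s_lower J \<phi>"
      unfolding hausdorff_dim_def s_lower_def
      using hausdorff_measure_attractor_zero
      by (intro Inf_superset_mono image_mono) (auto simp: less_imp_le)
    show "s_lower J \<phi> \<le> hausdorff_dim (attractor Jw)"
      unfolding hausdorff_dim_def
    proof (rule Inf_greatest, clarify)
      fix s :: real assume s: "0 \<le> s" "hausdorff_measure s (attractor Jw) = 0"
      show "s_lower J \<phi> \<le> ereal s"
      proof (rule ccontr)
        assume "\<not> s_lower J \<phi> \<le> ereal s"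
        then have "ereal s < s_lower J \<phi>" by simp
        from ereal_dense2[OF this] obtain t' where t': "ereal s < ereal t'" "ereal t' < s_lower J \<phi>"
          by blast
        define t where "t = (s + t') / 2"
        have t: "s < t" "t < t'" "0 < t" using t' s by (auto simp: t_def)
        have P': "0 \<le> lower_pressure J \<phi> t'"
        proof (rule ccontr)
          assume "\<not> ?thesis"
          then have "s_lower J \<phi> \<le> ereal t'"
            unfolding s_lower_def by (intro Inf_lower) auto
          with t'(2) show False by simp
        qed
        have "t' \<le> real DIM('a)"
          using P' lower_pressure_neg_above_dim[of t'] by (meson not_le)
        then have td: "t < real DIM('a)" using t by simp
        have "0 < lower_pressure J \<phi> t" using t(2) P' by (rule lower_pressure_pos)
        then have "m_pressure J \<phi> \<le> lower_pressure J \<phi> t"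
          unfolding m_pressure_def by (intro Inf_lower) auto
        then have Pm: "ereal m \<le> lower_pressure J \<phi> t" using m by simp
        define A where "A n = {k. 1 \<le> k \<and> real k \<le> exp (M * m * real n)}" for n
        have Mm: "M * m < m" "0 < M * m" using M m by auto
        have A_eq: "A n = {1..nat \<lfloor>exp (M * m * real n)\<rfloor>}" for n
          by (auto simp: A_def le_nat_iff le_floor_iff)
        have A: "finite (A n)" "A n \<noteq> {}" "A n \<subseteq> {1..}" for n
        proof -
          show "finite (A n)" by (simp add: A_eq)
          have "1 \<in> A n" using Mm by (simp add: A_def)
          then show "A n \<noteq> {}" by blast
          show "A n \<subseteq> {1..}" by (auto simp: A_def)
        qed
        have card: "real (card (A n)) \<le> exp (M * m * real n)" for n
          by (simp add: A_eq of_nat_floor)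
        define \<epsilon> where "\<epsilon> = (m - M * m) / 4"
        have "4 * \<epsilon> = m - M * m" by (simp add: \<epsilon>_def)
        then have \<epsilon>: "\<epsilon> > 0" "M * m < m - \<epsilon> - \<epsilon>" using Mm(1) by linarith+
        have "\<exists>b>0. \<forall>\<^sub>F n in sequentially. b * exp ((m - \<epsilon> - \<epsilon>) * real n) \<le> Z A t 1 n"
          using dichotomy[OF t(3) td]
        proof
          assume fin: "\<forall>n\<ge>1. (\<lambda>k. sup_deriv_norm J (\<phi> n k) powr t) summable_on {1..}"
          have P: "ereal (m - \<epsilon>) < lower_pressure J \<phi> t"
            using Pm \<epsilon>(1) by (intro less_le_trans[OF _ Pm]) simp
          have summ: "(\<lambda>k. q n [k] powr t) summable_on {1..}" if "n \<ge> 1" for n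
            using fin that unfolding q1 by simp
          have ratio: "(\<lambda>n. (\<Sum>k\<in>A n. q n [k] powr t) / (\<Sum>\<^sub>\<infinity>k\<in>{1..}. q n [k] powr t)) \<longlonglongrightarrow> 1"
            using finite_case[OF t(3) td fin] unfolding q1 A_def .
          show ?thesis
            using truncated_growth_summable[OF t(3) A summ ratio P \<epsilon>(1)] by blast
        next
          assume inf: "\<forall>n\<ge>1. \<not> (\<lambda>k. sup_deriv_norm J (\<phi> n k) powr t) summable_on {1..}"
          have "filterlim (\<lambda>n. \<Sum>k\<in>A n. q n [k] powr t) at_top sequentially"
            using infinite_case[OF t(3) td inf] unfolding q1 A_def .
          then obtain b where "b > 0"
            "\<forall>\<^sub>F n in sequentially. b * exp ((m - \<epsilon> - \<epsilon>) * real n) \<le> Z A t 1 n"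
            by (rule truncated_growth_divergent[OF t(3) A])
          then show ?thesis by blast
        qed
        then obtain b where b: "b > 0"
          "\<forall>\<^sub>F n in sequentially. b * exp ((m - \<epsilon> - \<epsilon>) * real n) \<le> Z A t 1 n" by blast
        obtain a where a: "a > 0" "\<And>n. a * exp ((m - \<epsilon> - \<epsilon>) * real n) \<le> Z A t 1 n"
          using exponential_lower_bound[OF _ b] Z_pos[OF A] by auto
        have "hausdorff_measure t (attractor Jw) \<noteq> 0"
          using hausdorff_measure_attractor_pos[OF t(3) A a \<epsilon>(2)] card by blast
        moreover have "hausdorff_measure t (attractor Jw) = 0"
          using s t by (intro hausdorff_measure_eq_0_mono[of s t]) auto
        ultimately show False by contradiction
      qed
    qed
  qed
qed

end
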